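(* Let $R=\mathbb{Z}\left[\frac{1+\sqrt{-7}}{2}\right]$ be the ring of algebraic integers in the number field $\mathbb{Q}[\sqrt{-7}]$. Then $\mathrm{Sp}_4(R)$ and $G_2(R)$ are not generated by a single conjugacy class, and so $\Delta_{1}(\mathrm{Sp}_4(R))=\Delta_{1}(G_2(R))=-\infty$.
   Context: $\mathrm{Sp}_4(R)$ and $G_2(R)$ are the groups of $R$-points of the simply connected split Chevalley–Demazure group schemes over $\mathbb{Z}$ of types $B_2$ and $G_2$. Let $G$ be a group. For $S\subset G$, $\langle\langle S\rangle\rangle$ is the smallest normal subgroup of $G$ containing $S$; $S$ is normally generating if $\langle\langle S\rangle\rangle=G$. For $A\in\langle\langle S\rangle\rangle$, $\|A\|_S$ is the smallest number $k\in\mathbb{N}_0$ such that $A$ is a product of $k$ elements each conjugate in $G$ to an element of $S\cup S^{-1}$; $\mathrm{diam}(\|\cdot\|_S)$ is the smallest $N\in\mathbb{N}$ with $\|A\|_S\le N$ for all $A\in G$, or $\infty$ if there is none. For $k\in\mathbb{N}$, $$\Delta_k(G):=\sup\{\mathrm{diam}(\|\cdot\|_S)\mid S\subset G,\ |S|\le k,\ \langle\langle S\rangle\rangle=G\}\in\mathbb{N}_0\cup\{\infty\},$$ with $\Delta_k(G):=-\infty$ if there is no normally generating $S\subset G$ with $|S|\le k$. *)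

theory Defs
  imports "HOL-Analysis.Analysis" "HOL-Algebra.Generated_Groups"
    "HOL-Computational_Algebra.Polynomial"
begin

section \<open>Conjugation-invariant word norms\<close>

definition conj_class :: "('a, 'b) monoid_scheme \<Rightarrow> 'a \<Rightarrow> 'a set" where
  "conj_class G a = {g \<otimes>\<^bsub>G\<^esub> a \<otimes>\<^bsub>G\<^esub> inv\<^bsub>G\<^esub> g | g. g \<in> carrier G}"

definition normal_closure :: "('a, 'b) monoid_scheme \<Rightarrow> 'a set \<Rightarrow> 'a set" where
  "normal_closure G S = \<Inter> {N. N \<lhd> G \<and> S \<subseteq> N}"

definition normally_generating :: "('a, 'b) monoid_scheme \<Rightarrow> 'a set \<Rightarrow> bool" where
  "normally_generating G S \<longleftrightarrow> S \<subseteq> carrier G \<and> normal_closure G S = carrier G"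

definition generated_by_conj_class :: "('a, 'b) monoid_scheme \<Rightarrow> bool" where
  "generated_by_conj_class G \<longleftrightarrow> (\<exists>a\<in>carrier G. generate G (conj_class G a) = carrier G)"

text \<open>Unspecified if \<^term>\<open>a\<close> lies outside the normal closure of \<^term>\<open>S\<close>.\<close>
definition conj_word_norm :: "('a, 'b) monoid_scheme \<Rightarrow> 'a set \<Rightarrow> 'a \<Rightarrow> nat" where
  "conj_word_norm G S a = (LEAST k. \<exists>xs. length xs = k \<and>
     set xs \<subseteq> (\<Union>s \<in> S \<union> m_inv G ` S. conj_class G s) \<and>
     foldr (mult G) xs \<one>\<^bsub>G\<^esub> = a)"

definition conj_diam :: "('a, 'b) monoid_scheme \<Rightarrow> 'a set \<Rightarrow> ereal" where
  "conj_diam G S =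
     (if \<exists>N::nat. \<forall>a\<in>carrier G. conj_word_norm G S a \<le> N
      then ereal (real (LEAST N. \<forall>a\<in>carrier G. conj_word_norm G S a \<le> N))
      else \<infinity>)"

definition Delta :: "nat \<Rightarrow> ('a, 'b) monoid_scheme \<Rightarrow> ereal" where
  "Delta k G =
     (if \<exists>S. finite S \<and> card S \<le> k \<and> normally_generating G S
      then SUP S \<in> {S. finite S \<and> card S \<le> k \<and> normally_generating G S}. conj_diam G S
      else -\<infinity>)"


section \<open>Matrix groups\<close>

definition matrix_group :: "(complex^'n^'n) set \<Rightarrow> (complex^'n^'n) monoid" where
  "matrix_group M = \<lparr>carrier = M, mult = (**), one = mat 1\<rparr>"

definition GL :: "(complex^'n^'n) monoid" where
  "GL = matrix_group {A. invertible A}"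

definition matrices_over :: "complex set \<Rightarrow> (complex^'n^'n) set" where
  "matrices_over R = {A. \<forall>i j. A $ i $ j \<in> R}"

text \<open>The symplectic group scheme is simply connected of type \<open>B\<^sub>2 = C\<^sub>2\<close>.\<close>

definition sympl_form :: "complex^4^4" where
  "sympl_form = vector [vector [ 0,  0, 1, 0],
                        vector [ 0,  0, 0, 1],
                        vector [-1,  0, 0, 0],
                        vector [ 0, -1, 0, 0]]"

definition Sp4 :: "complex set \<Rightarrow> (complex^4^4) monoid" where
  "Sp4 R = matrix_group
     {A \<in> matrices_over R. transpose A ** sympl_form ** A = sympl_form}"


section \<open>The Chevalley-Demazure construction\<close>

text \<open>
  Let \<^term>\<open>X\<close> range over the root vectors of a Chevalley basis of a complex semisimple Lie
  algebra, acting on a faithful representation by matrices with respect to a basis of an admissible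
  lattice. The root elements are the matrices \<open>exp (t X)\<close>. In the only representation used
  below one has \<open>X\<^sup>3 = 0\<close>, so that the exponential series stops after the quadratic term.
\<close>

definition root_element :: "complex^'n^'n \<Rightarrow> complex \<Rightarrow> complex^'n^'n" where
  "root_element X t = (\<chi> i j. mat 1 $ i $ j + t * X $ i $ j + t\<^sup>2 / 2 * (X ** X) $ i $ j)"

definition complex_chevalley_group :: "(complex^'n^'n) set \<Rightarrow> (complex^'n^'n) set" where
  "complex_chevalley_group \<X> = generate GL {root_element X t | X t. X \<in> \<X>}"

text \<open>The polynomials with integer coefficients in the matrix entries, as functions.\<close>

inductive_set int_poly_funs :: "((complex^'n^'n) \<Rightarrow> complex) set" where
  const: "(\<lambda>A. of_int c) \<in> int_poly_funs"
| entry: "(\<lambda>A. A $ i $ j) \<in> int_poly_funs"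
| add: "\<lbrakk>f \<in> int_poly_funs; g \<in> int_poly_funs\<rbrakk> \<Longrightarrow> (\<lambda>A. f A + g A) \<in> int_poly_funs"
| mult: "\<lbrakk>f \<in> int_poly_funs; g \<in> int_poly_funs\<rbrakk> \<Longrightarrow> (\<lambda>A. f A * g A) \<in> int_poly_funs"

text \<open>
  The coordinate ring \<open>\<int>[G]\<close> of the group scheme is the ring of functions on the complex group
  \<open>G\<close> generated over \<open>\<int>\<close> by the matrix entries \<open>y\<^sub>i\<^sub>j\<close>, and its group of
  \<open>R\<close>-points is \<open>Hom(\<int>[G], R)\<close>. A homomorphism \<open>\<phi>\<close> is
  determined by the matrix of the values \<open>\<phi>(y\<^sub>i\<^sub>j)\<close>. A matrix over \<open>R\<close> arises in this
  way iff its entries satisfy every polynomial relation over \<open>\<int>\<close> that holds between the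
  functions \<open>y\<^sub>i\<^sub>j\<close> on \<open>G\<close>; the comultiplication of \<open>\<int>[G]\<close> corresponds to
  multiplication of matrices. Here \<open>R\<close> is a subring of the complex numbers.
\<close>

definition chevalley_demazure_points ::
    "(complex^'n^'n) set \<Rightarrow> complex set \<Rightarrow> (complex^'n^'n) monoid" where
  "chevalley_demazure_points \<X> R = matrix_group
     {A \<in> matrices_over R.
        \<forall>f\<in>int_poly_funs. (\<forall>B\<in>complex_chevalley_group \<X>. f B = 0) \<longrightarrow> f A = 0}"


section \<open>The root vectors of type \<open>G\<^sub>2\<close>\<close>

text \<open>
  The representation is the one of dimension 7, whose weights are \<open>0\<close> and the six short roots
  \<open>\<plusminus>\<epsilon>\<^sub>1, \<plusminus>\<epsilon>\<^sub>2, \<plusminus>\<epsilon>\<^sub>3\<close> with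
  \<open>\<epsilon>\<^sub>1 + \<epsilon>\<^sub>2 + \<epsilon>\<^sub>3 = 0\<close>. The coordinates are indexed by the integers modulo 7:
  index \<open>0\<close> has weight \<open>0\<close>, the indices \<open>1, 2, 4\<close> have weights
  \<open>\<epsilon>\<^sub>1, \<epsilon>\<^sub>2, \<epsilon>\<^sub>3\<close>, and negating an index negates its weight. Thus for
  every nonzero \<open>a\<close> the weights of \<open>a, 2a, 4a\<close> add up to \<open>0\<close>.

  For \<open>a \<noteq> 0\<close>, \<open>g2_short a\<close> is a root vector for the short root which is the weight
  of \<open>a\<close>; for distinct \<open>i, j \<in> {1, 2, 4}\<close>, \<open>g2_long i j\<close> is a root vector for
  the long root which is the difference of the weights of \<open>i\<close> and \<open>j\<close>.
  Some of these differ by a sign from the members of a Chevalley basis, depending on the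
  convention used; this does not affect the set of root elements. As for type \<open>G\<^sub>2\<close> the root
  lattice is the weight lattice, every faithful representation yields the simply connected group.
\<close>

definition matrix_unit :: "'n \<Rightarrow> 'n \<Rightarrow> complex^'n^'n" where
  "matrix_unit i j = (\<chi> k l. if k = i \<and> l = j then 1 else 0)"

definition g2_short :: "7 \<Rightarrow> complex^7^7" where
  "g2_short a = 2 *\<^sub>R matrix_unit a 0 - matrix_unit 0 (-a)
     + matrix_unit (-2*a) (4*a) - matrix_unit (-4*a) (2*a)"

definition g2_long :: "7 \<Rightarrow> 7 \<Rightarrow> complex^7^7" where
  "g2_long i j = matrix_unit i j - matrix_unit (-j) (-i)"

definition g2_root_vectors :: "(complex^7^7) set" where
  "g2_root_vectors =
     {g2_short a | a. a \<noteq> 0} \<union> {g2_long i j | i j. i \<in> {1, 2, 4} \<and> j \<in> {1, 2, 4} \<and> i \<noteq> j}"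

definition G2 :: "complex set \<Rightarrow> (complex^7^7) monoid" where
  "G2 R = chevalley_demazure_points g2_root_vectors R"

lemma exhaust_7: "x = 0 \<or> x = 1 \<or> x = 2 \<or> x = 3 \<or> x = 4 \<or> x = 5 \<or> x = 6" for x :: 7
proof (induct x)
  case (of_int z)
  then have "z = 0 \<or> z = 1 \<or> z = 2 \<or> z = 3 \<or> z = 4 \<or> z = 5 \<or> z = 6" by fastforce
  then show ?case by auto
qed

lemma matrix_unit_mult:
  "matrix_unit i j ** matrix_unit k l = (if j = k then matrix_unit i l else 0)"
  by (auto simp: matrix_unit_def matrix_matrix_mult_def vec_eq_iff if_distrib[of "\<lambda>x. x * _"]
           cong: if_cong)

lemma matrix_mult_distribs:
  fixes A A' :: "complex^'n^'m" and B B' :: "complex^'p^'n"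
  shows "(A + A') ** B = A ** B + A' ** B" "A ** (B + B') = A ** B + A ** B'"
    "(A - A') ** B = A ** B - A' ** B" "A ** (B - B') = A ** B - A ** B'"
    "(- A) ** B = - (A ** B)" "A ** (- B) = - (A ** B)"
    "(c *\<^sub>R A) ** B = c *\<^sub>R (A ** B)" "A ** (c *\<^sub>R B) = c *\<^sub>R (A ** B)"
  by (simp_all add: matrix_matrix_mult_def vec_eq_iff sum_negf sum.distrib sum_subtractf
        scaleR_sum_right algebra_simps)

lemma numeral_times_matrix: "numeral n * A = numeral n *\<^sub>R A" for A :: "complex^'n^'m"
  by (simp add: vec_eq_iff scaleR_conv_of_real)

lemma residues_7:
  shows "- 1 = (6::7)" "- 2 = (5::7)" "- 3 = (4::7)" "- 4 = (3::7)" "- 5 = (2::7)" "- 6 = (1::7)" "- 8 = (6::7)" "- 10 = (4::7)" "- 12 = (2::7)" "- 16 = (5::7)" "- 20 = (1::7)" "- 24 = (4::7)"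
    "8 = (1::7)" "10 = (3::7)" "12 = (5::7)" "16 = (2::7)" "20 = (6::7)" "24 = (3::7)"
  by simp_all

lemma g2_root_vector_cube:
  assumes "X \<in> g2_root_vectors"
  shows "X ** X ** X = 0"
proof -
  have "g2_short a ** g2_short a ** g2_short a = 0" if "a \<noteq> 0" for a
    using exhaust_7[of a] that
    by (elim disjE) (simp_all add: g2_short_def residues_7 matrix_unit_mult matrix_mult_distribs)
  moreover have "g2_long i j ** g2_long i j ** g2_long i j = 0"
    if "i \<in> {1, 2, 4}" "j \<in> {1, 2, 4}" "i \<noteq> j" for i j
    using that by (auto simp: g2_long_def residues_7 matrix_unit_mult matrix_mult_distribs)
  ultimately show ?thesis
    using assms by (auto simp: g2_root_vectors_def)
qed

text \<open>
  The Chevalley--Serre relations for the Cartan matrix of type \<open>G\<^sub>2\<close>, with the short simple root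
  \<open>\<epsilon>\<^sub>2\<close> and the long simple root \<open>\<epsilon>\<^sub>1 - \<epsilon>\<^sub>2\<close>.
\<close>

lemma g2_serre_relations:
  defines "br \<equiv> \<lambda>A B :: complex^7^7. A ** B - B ** A"
  defines "e1 \<equiv> g2_short 2" and "f1 \<equiv> - g2_short (-2)"
      and "e2 \<equiv> g2_long 1 2" and "f2 \<equiv> g2_long 2 1"
  defines "h1 \<equiv> br e1 f1" and "h2 \<equiv> br e2 f2"
  shows "br h1 h2 = 0" "br e1 f2 = 0" "br e2 f1 = 0"
    "br h1 e1 = 2 *\<^sub>R e1" "br h1 e2 = (-3) *\<^sub>R e2" "br h2 e1 = (-1) *\<^sub>R e1" "br h2 e2 = 2 *\<^sub>R e2"
    "br h1 f1 = (-2) *\<^sub>R f1" "br h1 f2 = 3 *\<^sub>R f2" "br h2 f1 = f1" "br h2 f2 = (-2) *\<^sub>R f2"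
    "br e1 (br e1 (br e1 (br e1 e2))) = 0" "br e2 (br e2 e1) = 0"
    "br f1 (br f1 (br f1 (br f1 f2))) = 0" "br f2 (br f2 f1) = 0"
  unfolding assms g2_short_def g2_long_def
  by (simp_all add: residues_7 matrix_unit_mult matrix_mult_distribs numeral_times_matrix
        scaleR_add_right scaleR_diff_right) (simp_all add: vec_eq_iff matrix_unit_def scaleR_conv_of_real)


section \<open>The ring \<open>\<int>[(1 + \<surd>-7) / 2]\<close>\<close>

definition int_adjoin :: "complex \<Rightarrow> complex set" where
  "int_adjoin x = {poly (map_poly of_int p) x | p :: int poly. True}"

definition ring_Q_sqrt_neg7 :: "complex set" where
  "ring_Q_sqrt_neg7 = int_adjoin ((1 + csqrt (-7)) / 2)"

end

theory Submission
  imports Defs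
begin

text \<open>
  With \<open>\<omega> = (1 + \<surd>-7) / 2\<close> the ring is \<open>R = \<int> + \<int>\<omega>\<close>,
  where \<open>\<omega>\<^sup>2 = \<omega> - 2\<close>. As \<open>2 = \<omega> (1 - \<omega>)\<close> splits
  in \<open>R\<close>, there are two ring homomorphisms from \<open>R\<close> onto the field
  \<open>F\<^sub>2\<close>, sending \<open>\<omega>\<close> to \<open>0\<close> and to \<open>1\<close>. The
  two finite groups \<open>Sp\<^sub>4(F\<^sub>2)\<close> (the symmetric group on six letters) and
  \<open>G\<^sub>2(F\<^sub>2)\<close> both have a subgroup of index two, that is, a sign character that is
  nontrivial on some root element. Composing it with the two reductions yields two sign characters of the
  group over \<open>R\<close>. The root elements with parameters \<open>\<omega>\<close> and
  \<open>1 - \<omega>\<close> show that the two characters are independent: each of the two elements is odd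
  for one of them and trivial under the other reduction. Whatever element \<open>a\<close> is given, one of
  the two characters or their product is trivial on \<open>a\<close>; its kernel is a proper normal subgroup
  containing \<open>a\<close>. Hence no single element is normally generating
  (\<open>proper_normal_subgroup_containing\<close>,
  \<open>matrix_group_no_single_normal_generator\<close>).

  The sign characters are signs of permutations. The group \<open>Sp\<^sub>4(F\<^sub>2)\<close> permutes the
  six elliptic quadratic forms that polarise to the symplectic form, and a transvection exchanges two of
  them and fixes the other four (\<open>family_sign_transvection\<close>). The group
  \<open>G\<^sub>2(F\<^sub>2)\<close> permutes the 63 lines of the split Cayley hexagon, which are the
  planes in \<open>F\<^sub>2\<^sup>7\<close> such that an invariant alternating trilinear form vanishes as
  soon as two of its arguments lie in the plane; a short root element is an involution moving 54 of them,
  hence a product of 27 transpositions (\<open>card_moved_lines\<close>).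

  The group \<open>G\<^sub>2(R)\<close> consists of the matrices over \<open>R\<close> that satisfy all
  integral polynomial relations valid on the complex group. In particular they preserve the trilinear form,
  whose invariance is such a relation. What needs an argument is that these matrices form a group. A product
  of root elements with integral parameters is an integral matrix, and these products are Zariski dense in
  the complex group, because a polynomial in one variable that vanishes on \<open>\<int>\<close> is zero
  (\<open>integral_products_dense\<close>). For an integral relation \<open>f\<close>, the condition
  \<open>f (A Y) = 0\<close> on an integral matrix \<open>Y\<close> splits into two integral relations, the
  coordinates with respect to \<open>1, \<omega>\<close>; by density these hold on the complex group and
  therefore at every point \<open>B\<close> over \<open>R\<close>, which gives \<open>f (A B) = 0\<close>
  (\<open>points_mult\<close>).
\<close>

section \<open>Sign characters and normal generation\<close>

lemma sign_character_kernel_normal: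
  fixes h :: "'a \<Rightarrow> int"
  assumes "group G"
    and mult: "\<And>x y. x \<in> carrier G \<Longrightarrow> y \<in> carrier G \<Longrightarrow> h (x \<otimes>\<^bsub>G\<^esub> y) = h x * h y"
    and vals: "\<And>x. x \<in> carrier G \<Longrightarrow> \<bar>h x\<bar> = 1"
  shows "{x \<in> carrier G. h x = 1} \<lhd> G"
proof -
  interpret group G by fact
  have one: "h \<one>\<^bsub>G\<^esub> = 1"
    using mult[of "\<one>\<^bsub>G\<^esub>" "\<one>\<^bsub>G\<^esub>"] vals[of "\<one>\<^bsub>G\<^esub>"] by auto
  have inv: "h x * h (inv\<^bsub>G\<^esub> x) = 1" if "x \<in> carrier G" for x
    using mult[of x "inv\<^bsub>G\<^esub> x"] one that by simp
  show ?thesis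
    unfolding normal_inv_iff
  proof (intro conjI ballI)
    show "subgroup {x \<in> carrier G. h x = 1} G"
      by (rule subgroupI) (use one inv in \<open>force simp: mult\<close>)+
  next
    fix x y assume x: "x \<in> carrier G" and y: "y \<in> {x \<in> carrier G. h x = 1}"
    then have "h (x \<otimes>\<^bsub>G\<^esub> y \<otimes>\<^bsub>G\<^esub> inv\<^bsub>G\<^esub> x) = 1"
      using inv[of x] by (simp add: mult)
    then show "x \<otimes>\<^bsub>G\<^esub> y \<otimes>\<^bsub>G\<^esub> inv\<^bsub>G\<^esub> x \<in> {x \<in> carrier G. h x = 1}"
      using x y by auto
  qed
qed

text \<open>
  The values of two independent sign characters at \<open>a\<close> cannot rule out all three of the
  nontrivial characters \<open>h1\<close>, \<open>h2\<close>, \<open>h1 h2\<close>: if \<open>h1\<close> and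
  \<open>h2\<close> are both \<open>-1\<close> at \<open>a\<close>, then the product is \<open>1\<close>
  there. The desired subgroup is the kernel of a character that is trivial at \<open>a\<close>, and
  \<open>u\<close> or \<open>v\<close> lies outside it.
\<close>
lemma proper_normal_subgroup_containing:
  fixes h1 h2 :: "'a \<Rightarrow> int"
  assumes "group G"
    and mult1: "\<And>x y. x \<in> carrier G \<Longrightarrow> y \<in> carrier G \<Longrightarrow> h1 (x \<otimes>\<^bsub>G\<^esub> y) = h1 x * h1 y"
    and mult2: "\<And>x y. x \<in> carrier G \<Longrightarrow> y \<in> carrier G \<Longrightarrow> h2 (x \<otimes>\<^bsub>G\<^esub> y) = h2 x * h2 y"
    and vals1: "\<And>x. x \<in> carrier G \<Longrightarrow> \<bar>h1 x\<bar> = 1"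
    and vals2: "\<And>x. x \<in> carrier G \<Longrightarrow> \<bar>h2 x\<bar> = 1"
    and u: "u \<in> carrier G" "h1 u = -1" "h2 u = 1"
    and v: "v \<in> carrier G" "h1 v = 1" "h2 v = -1"
    and a: "a \<in> carrier G"
  obtains N where "N \<lhd> G" "a \<in> N" "N \<noteq> carrier G"
proof -
  have "{x \<in> carrier G. h1 x = 1} \<lhd> G" "{x \<in> carrier G. h2 x = 1} \<lhd> G"
    "{x \<in> carrier G. h1 x * h2 x = 1} \<lhd> G"
    using assms(1) vals1 vals2
    by (auto intro!: sign_character_kernel_normal simp: mult1 mult2 abs_mult)
  moreover have "h1 a = 1 \<or> h2 a = 1 \<or> h1 a * h2 a = 1"
    using vals1[OF a] vals2[OF a] by (auto simp: abs_if split: if_splits)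
  moreover have "u \<notin> {x \<in> carrier G. h1 x = 1}" "v \<notin> {x \<in> carrier G. h2 x = 1}"
    "u \<notin> {x \<in> carrier G. h1 x * h2 x = 1}"
    using u v by auto
  ultimately show ?thesis
    using that a u(1) v(1) by (elim disjE) (blast+)
qed

lemma no_single_normal_generator:
  assumes "group G"
    and proper: "\<And>a. a \<in> carrier G \<Longrightarrow> \<exists>N. N \<lhd> G \<and> a \<in> N \<and> N \<noteq> carrier G"
  shows "\<not> generated_by_conj_class G" "Delta 1 G = -\<infinity>"
proof -
  interpret group G by fact
  show "\<not> generated_by_conj_class G"
  proof
    assume "generated_by_conj_class G"
    then obtain a where a: "a \<in> carrier G" "generate G (conj_class G a) = carrier G"
      by (auto simp: generated_by_conj_class_def)
    obtain N where N: "N \<lhd> G" "a \<in> N" "N \<noteq> carrier G"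
      using proper[OF a(1)] by blast
    have "conj_class G a \<subseteq> N"
      using N by (auto simp: conj_class_def dest: normal_invE(2))
    then have "generate G (conj_class G a) \<subseteq> N"
      by (rule generate_subgroup_incl) (rule normal_invE(1)[OF N(1)])
    then show False
      using a N subgroup.subset[OF normal_invE(1)[OF N(1)]] by auto
  qed
  have "\<not> normally_generating G S" if S: "finite S" "card S \<le> 1" for S
  proof
    assume gen: "normally_generating G S"
    have "\<exists>a\<in>carrier G. S \<subseteq> {a}"
    proof (cases "S = {}")
      case False
      then obtain a where "S = {a}"
        using S by (metis One_nat_def card_1_singletonE card_gt_0_iff le_antisym less_eq_Suc_le)
      then show ?thesis
        using gen by (auto simp: normally_generating_def)
    qed auto
    then obtain a where a: "a \<in> carrier G" "S \<subseteq> {a}" by blast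
    obtain N where N: "N \<lhd> G" "a \<in> N" "N \<noteq> carrier G"
      using proper[OF a(1)] by blast
    then have "normal_closure G S \<subseteq> N"
      using a unfolding normal_closure_def by blast
    then show False
      using gen N subgroup.subset[OF normal_invE(1)[OF N(1)]]
      by (auto simp: normally_generating_def)
  qed
  then show "Delta 1 G = -\<infinity>"
    by (auto simp: Delta_def)
qed

section \<open>The two residue maps onto the field with two elements\<close>

definition omega :: complex where
  "omega = (1 + csqrt (-7)) / 2"

lemma omega_mult_self: "omega * omega = omega - 2"
proof -
  have "csqrt (-7) * csqrt (-7) = -7"
    using power2_csqrt[of "-7"] by (simp add: power2_eq_square)
  then show ?thesis
    unfolding omega_def by (simp add: field_simps)
qed

lemma Im_omega_nonzero: "Im omega \<noteq> 0"
  unfolding omega_def by simp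

lemma omega_coordinates_unique:
  assumes "of_int a + of_int b * omega = of_int c + of_int d * omega"
  shows "a = c" "b = d"
proof -
  have "Im (of_int a + of_int b * omega) = Im (of_int c + of_int d * omega)"
    using assms by simp
  then show "b = d"
    using Im_omega_nonzero by simp
  then show "a = c"
    using assms by simp
qed

lemma omega_coordinates_mult:
  "(of_int a + of_int b * omega) * (of_int c + of_int d * omega) =
   of_int (a * c - 2 * b * d) + of_int (a * d + b * c + b * d) * omega"
proof -
  have "(of_int a + of_int b * omega) * (of_int c + of_int d * omega) =
      of_int (a * c) + of_int (a * d + b * c) * omega + of_int (b * d) * (omega * omega)"
    by (simp add: algebra_simps)
  then show ?thesis
    unfolding omega_mult_self by (simp add: algebra_simps)
qed

text \<open>
  By Horner's scheme a polynomial is evaluated by multiplying by \<open>\<omega>\<close> and adding an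
  integer, which keeps the form \<open>a + b\<omega>\<close> because
  \<open>\<omega>\<^sup>2 = \<omega> - 2\<close>.
\<close>
lemma ring_Q_sqrt_neg7_eq:
  "ring_Q_sqrt_neg7 = {of_int a + of_int b * omega | a b. True}"
proof (intro equalityI subsetI)
  fix z assume "z \<in> ring_Q_sqrt_neg7"
  then obtain p :: "int poly" where z: "z = poly (map_poly of_int p) omega"
    by (auto simp: ring_Q_sqrt_neg7_def int_adjoin_def omega_def)
  have "\<exists>a b. poly (map_poly of_int p) omega = of_int a + of_int b * omega"
  proof (induction p)
    case 0
    show ?case by (intro exI[of _ 0]) simp
  next
    case (pCons k p)
    then obtain a b where "poly (map_poly of_int p) omega = of_int a + of_int b * omega"
      by blast
    then have "poly (map_poly of_int (pCons k p)) omega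
        = of_int k + (of_int 0 + of_int 1 * omega) * (of_int a + of_int b * omega)"
      by (simp add: map_poly_pCons)
    also have "\<dots> = of_int (k - 2 * b) + of_int (a + b) * omega"
      by (subst omega_coordinates_mult) (simp add: algebra_simps)
    finally show ?case by blast
  qed
  then show "z \<in> {of_int a + of_int b * omega | a b. True}"
    by (simp add: z)
next
  fix z assume "z \<in> {of_int a + of_int b * omega | a b. True}"
  then obtain a b where "z = poly (map_poly of_int [:a, b:]) omega"
    by (auto simp: map_poly_pCons mult.commute)
  then show "z \<in> ring_Q_sqrt_neg7"
    by (auto simp: ring_Q_sqrt_neg7_def int_adjoin_def omega_def)
qed

lemma in_ring_Q_sqrt_neg7E:
  assumes "z \<in> ring_Q_sqrt_neg7"
  obtains a b where "z = of_int a + of_int b * omega"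
  using assms by (auto simp: ring_Q_sqrt_neg7_eq)

lemma in_ring_Q_sqrt_neg7I: "z = of_int a + of_int b * omega \<Longrightarrow> z \<in> ring_Q_sqrt_neg7"
  by (auto simp: ring_Q_sqrt_neg7_eq)

lemma ring_Q_sqrt_neg7_closed:
  shows ring_of_int: "of_int k \<in> ring_Q_sqrt_neg7"
    and ring_omega: "omega \<in> ring_Q_sqrt_neg7"
    and ring_add: "x \<in> ring_Q_sqrt_neg7 \<Longrightarrow> y \<in> ring_Q_sqrt_neg7 \<Longrightarrow> x + y \<in> ring_Q_sqrt_neg7"
    and ring_mult: "x \<in> ring_Q_sqrt_neg7 \<Longrightarrow> y \<in> ring_Q_sqrt_neg7 \<Longrightarrow> x * y \<in> ring_Q_sqrt_neg7"
proof -
  show "of_int k \<in> ring_Q_sqrt_neg7"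
    by (rule in_ring_Q_sqrt_neg7I[of _ k 0]) simp
  show "omega \<in> ring_Q_sqrt_neg7"
    by (rule in_ring_Q_sqrt_neg7I[of _ 0 1]) simp
  assume "x \<in> ring_Q_sqrt_neg7" "y \<in> ring_Q_sqrt_neg7"
  then obtain a b c d where xy: "x = of_int a + of_int b * omega" "y = of_int c + of_int d * omega"
    by (metis in_ring_Q_sqrt_neg7E)
  show "x + y \<in> ring_Q_sqrt_neg7"
    by (rule in_ring_Q_sqrt_neg7I[of _ "a + c" "b + d"]) (simp add: xy algebra_simps)
  show "x * y \<in> ring_Q_sqrt_neg7"
    unfolding xy omega_coordinates_mult by (rule in_ring_Q_sqrt_neg7I) (rule refl)
qed

lemma ring_minus: "x \<in> ring_Q_sqrt_neg7 \<Longrightarrow> - x \<in> ring_Q_sqrt_neg7"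
  using ring_mult[OF ring_of_int[of "-1"], of x] by simp

lemma ring_diff: "x \<in> ring_Q_sqrt_neg7 \<Longrightarrow> y \<in> ring_Q_sqrt_neg7 \<Longrightarrow> x - y \<in> ring_Q_sqrt_neg7"
  using ring_add[of x "- y"] ring_minus[of y] by simp

lemma ring_zero: "0 \<in> ring_Q_sqrt_neg7" and ring_one: "1 \<in> ring_Q_sqrt_neg7"
  using ring_of_int[of 0] ring_of_int[of 1] by simp_all

lemma ring_sum: "(\<And>i. i \<in> I \<Longrightarrow> f i \<in> ring_Q_sqrt_neg7) \<Longrightarrow> sum f I \<in> ring_Q_sqrt_neg7"
  by (induction I rule: infinite_finite_induct) (auto intro: ring_zero ring_add)

lemma F2_cases: "x = 0 \<or> x = 1" for x :: 2
  using exhaust_2[of x] by auto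

text \<open>
  The reduction to \<open>F\<^sub>2\<close> that sends \<open>\<omega>\<close> to \<open>c\<close>. Both
  elements \<open>c\<close> of \<open>F\<^sub>2\<close> are admissible, since each is a root of
  \<open>X\<^sup>2 - X + 2\<close> modulo 2. The value is meaningful only on the ring.
\<close>
definition residue :: "2 \<Rightarrow> complex \<Rightarrow> 2" where
  "residue c z = (THE r. \<exists>a b. z = of_int a + of_int b * omega \<and> r = of_int a + of_int b * c)"

lemma residue_coordinates [simp]:
  "residue c (of_int a + of_int b * omega) = of_int a + of_int b * c"
  unfolding residue_def
  by (rule the_equality) (use omega_coordinates_unique in blast)+

lemma residue_of_int [simp]: "residue c (of_int k) = of_int k"
  using residue_coordinates[of c k 0] by simp

lemma residue_0 [simp]: "residue c 0 = 0" and residue_1 [simp]: "residue c 1 = 1"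
  using residue_of_int[of c 0] residue_of_int[of c 1] by simp_all

lemma residue_omega [simp]: "residue c omega = c"
  using residue_coordinates[of c 0 1] by simp

lemma residue_add [simp]:
  assumes "x \<in> ring_Q_sqrt_neg7" "y \<in> ring_Q_sqrt_neg7"
  shows "residue c (x + y) = residue c x + residue c y"
proof -
  obtain a b a' b' where xy: "x = of_int a + of_int b * omega" "y = of_int a' + of_int b' * omega"
    using assms by (metis in_ring_Q_sqrt_neg7E)
  have "x + y = of_int (a + a') + of_int (b + b') * omega"
    by (simp add: xy algebra_simps)
  then show ?thesis
    unfolding xy by (simp only: residue_coordinates) (simp add: algebra_simps)
qed

lemma residue_mult [simp]:
  assumes "x \<in> ring_Q_sqrt_neg7" "y \<in> ring_Q_sqrt_neg7"
  shows "residue c (x * y) = residue c x * residue c y"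
proof -
  obtain a b a' b' where xy: "x = of_int a + of_int b * omega" "y = of_int a' + of_int b' * omega"
    using assms by (metis in_ring_Q_sqrt_neg7E)
  have [simp]: "z * 2 = 0" for z :: 2
    using F2_cases[of z] by auto
  have [simp]: "c * c = c" "c * (c * z) = c * z" for z
    using F2_cases[of c] by auto
  have "of_int (a * a' - 2 * b * b') + of_int (a * b' + b * a' + b * b') * c
      = (of_int a + of_int b * c) * (of_int a' + of_int b' * c)"
    by (simp add: algebra_simps)
  then show ?thesis
    unfolding xy omega_coordinates_mult residue_coordinates .
qed

lemma residue_sum:
  "(\<And>i. i \<in> I \<Longrightarrow> f i \<in> ring_Q_sqrt_neg7) \<Longrightarrow> residue c (sum f I) = (\<Sum>i\<in>I. residue c (f i))"
  by (induction I rule: infinite_finite_induct) (auto simp: ring_sum)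

definition residue_vec :: "2 \<Rightarrow> complex^'n \<Rightarrow> 2^'n" where
  "residue_vec c x = (\<chi> i. residue c (x $ i))"

definition residue_matrix :: "2 \<Rightarrow> complex^'n^'m \<Rightarrow> 2^'n^'m" where
  "residue_matrix c A = (\<chi> i j. residue c (A $ i $ j))"

lemma residue_matrix_mult:
  assumes "A \<in> matrices_over ring_Q_sqrt_neg7" "B \<in> matrices_over ring_Q_sqrt_neg7"
  shows "residue_matrix c (A ** B) = residue_matrix c A ** residue_matrix c B"
  using assms
  by (simp add: residue_matrix_def matrices_over_def matrix_matrix_mult_def vec_eq_iff
      residue_sum ring_mult)

lemma residue_matrix_1 [simp]: "residue_matrix c (mat 1) = mat 1"
  by (simp add: residue_matrix_def mat_def vec_eq_iff)

lemma residue_matrix_vector_mult: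
  assumes "A \<in> matrices_over ring_Q_sqrt_neg7" "\<And>i. x $ i \<in> ring_Q_sqrt_neg7"
  shows "residue_vec c (A *v x) = residue_matrix c A *v residue_vec c x"
  using assms
  by (simp add: residue_matrix_def residue_vec_def matrices_over_def matrix_vector_mult_def
      vec_eq_iff residue_sum ring_mult)

lemma matrices_over_ring_mult:
  assumes "A \<in> matrices_over ring_Q_sqrt_neg7" "B \<in> matrices_over ring_Q_sqrt_neg7"
  shows "A ** B \<in> matrices_over ring_Q_sqrt_neg7"
  using assms by (simp add: matrices_over_def matrix_matrix_mult_def ring_sum ring_mult)

lemma matrices_over_ring_1: "mat 1 \<in> matrices_over ring_Q_sqrt_neg7"
  by (simp add: matrices_over_def mat_def ring_one ring_zero)

lemma residue_diff:
  assumes "x \<in> ring_Q_sqrt_neg7" "y \<in> ring_Q_sqrt_neg7"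
  shows "residue c (x - y) = residue c x - residue c y"
  using residue_add[of "x - y" y c] assms by (simp add: ring_diff algebra_simps)

text \<open>
  A section of the reduction of vectors, with entries 0 and 1. It transports identities between complex
  vectors to identities over \<open>F\<^sub>2\<close> that hold for all vectors.
\<close>
definition lift_vec :: "2^'n \<Rightarrow> complex^'n" where
  "lift_vec x = (\<chi> i. if x $ i = 0 then 0 else 1)"

lemma lift_vec_ring: "lift_vec x $ i \<in> ring_Q_sqrt_neg7"
  by (simp add: lift_vec_def ring_zero ring_one)

lemma residue_lift_vec [simp]: "residue_vec c (lift_vec x) = x"
  using F2_cases by (force simp: residue_vec_def lift_vec_def vec_eq_iff)

lemma matrix_vector_mult_ring:
  assumes "A \<in> matrices_over ring_Q_sqrt_neg7" "\<And>i. x $ i \<in> ring_Q_sqrt_neg7"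
  shows "(A *v x) $ i \<in> ring_Q_sqrt_neg7"
  using assms by (simp add: matrices_over_def matrix_vector_mult_def ring_sum ring_mult)

lemma F2_add_self [simp]: "x + x = 0" "x + (x + y) = y" for x y :: 2
  using F2_cases[of x] by auto

lemma F2_minus [simp]: "x - y = x + y" "- x = x" for x y :: 2
  using F2_cases[of y] F2_cases[of x] by auto

lemma F2_double [simp]: "2 * x = 0" "x * 2 = 0" for x :: 2
  using F2_cases[of x] by auto

lemma F2_vec_add_self [simp]: "x + x = 0" "x + (x + y) = y" "x + (y + x) = y" for x y :: "2^'n"
  by (simp_all add: vec_eq_iff add.commute[of "y $ _" "x $ _"])

section \<open>Signs of matrix groups acting on a family of sets of vectors\<close>

text \<open>
  An involution is a product of disjoint transpositions, one for every pair of moved points. The induction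
  removes one of them.
\<close>
lemma sign_involution:
  assumes "finite {x. p x \<noteq> x}" "\<And>x. p (p x) = x"
  shows "sign p = (-1) ^ (card {x. p x \<noteq> x} div 2) \<and> even (card {x. p x \<noteq> x})"
  using assms
proof (induction "card {x. p x \<noteq> x}" arbitrary: p rule: less_induct)
  case less
  show ?case
  proof (cases "{x. p x \<noteq> x} = {}")
    case True
    then have "p = id" by auto
    then show ?thesis by simp
  next
    case False
    then obtain a where a: "p a \<noteq> a" by blast
    define b where "b = p a"
    have b: "p b = a" "a \<noteq> b" using less.prems(2) a by (auto simp: b_def)
    define p' where "p' = Transposition.transpose a b \<circ> p"
    have p': "p' x = (if x = a \<or> x = b then x else p x)" for x
      using less.prems(2) b unfolding p'_def o_def b_def
      by (metis transpose_apply_first transpose_apply_second transpose_apply_other)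
    have moved: "{x. p x \<noteq> x} = insert a (insert b {x. p' x \<noteq> x})"
      using a b by (auto simp: p')
    have fin: "finite {x. p' x \<noteq> x}"
      using less.prems(1) unfolding moved by simp
    have "a \<notin> {x. p' x \<noteq> x}" "b \<notin> {x. p' x \<noteq> x}"
      by (auto simp: p')
    then have card: "card {x. p x \<noteq> x} = card {x. p' x \<noteq> x} + 2"
      using fin b(2) by (simp add: moved)
    have "p' (p' x) = x" for x
    proof (cases "x = a \<or> x = b")
      case False
      then have "p x \<noteq> a" "p x \<noteq> b"
        using less.prems(2) b by metis+
      then show ?thesis
        using False less.prems(2) by (simp add: p')
    qed (simp add: p')
    then have IH: "sign p' = (-1) ^ (card {x. p' x \<noteq> x} div 2)" "even (card {x. p' x \<noteq> x})"
      using less.hyps[of p'] fin card by auto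
    have "permutation p"
      unfolding permutation
      using less.prems by (auto intro: o_bij[of p p] simp: fun_eq_iff)
    then have "sign p' = - sign p"
      using b(2) by (simp add: p'_def sign_compose permutation_swap_id sign_swap_id)
    then show ?thesis
      using IH card by (auto simp: div_add_self2)
  qed
qed

lemma sign_on_involution:
  assumes "finite X" "\<And>S. S \<in> X \<Longrightarrow> f S \<in> X" "\<And>S. S \<in> X \<Longrightarrow> f (f S) = S"
  shows "sign_on X f = (-1) ^ (card {S \<in> X. f S \<noteq> S} div 2)"
proof -
  have "{S. restrict_id f X S \<noteq> S} = {S \<in> X. f S \<noteq> S}"
    by (auto simp: restrict_id_def)
  then show ?thesis
    using sign_involution[of "restrict_id f X"] assms
    by (simp add: sign_on_def restrict_id_def)
qed

definition preserves :: "(2^'n) set set \<Rightarrow> 2^'n^'n \<Rightarrow> bool" where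
  "preserves X M \<longleftrightarrow> invertible M \<and> (\<forall>S\<in>X. (\<lambda>x. M *v x) -` S \<in> X)"

text \<open>
  The matrices act by preimages rather than by images, so that no inverse matrix is needed to define the
  action on zero sets of functions. This is an action from the right, but its sign is multiplicative all the
  same, as signs commute.
\<close>
definition family_sign :: "(2^'n) set set \<Rightarrow> 2^'n^'n \<Rightarrow> int" where
  "family_sign X M = sign_on X (\<lambda>S. (\<lambda>x. M *v x) -` S)"

lemma invertible_surj:
  assumes "invertible (M :: 'a::comm_ring_1^'n^'n)"
  shows "surj (\<lambda>x. M *v x)"
proof -
  obtain N where "M ** N = mat 1"
    using assms by (auto simp: invertible_def)
  then have "M *v (N *v x) = x" for x
    by (simp add: matrix_vector_mul_assoc)
  then show ?thesis
    by (metis surjI)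
qed

lemma invertible_card_vimage:
  fixes M :: "2^'n^'n"
  assumes "invertible M"
  shows "card ((\<lambda>x. M *v x) -` S) = card S"
proof -
  have "surj (\<lambda>x. M *v x)"
    using invertible_surj[OF assms] .
  moreover from this have "inj (\<lambda>x. M *v x)"
    by (simp add: finite_UNIV_surj_inj)
  ultimately show ?thesis
    by (intro card_vimage_inj) auto
qed

lemma preserves_bij:
  assumes "preserves X M"
  shows "bij_betw (\<lambda>S. (\<lambda>x. M *v x) -` S) X X"
proof -
  have "inj_on (\<lambda>S. (\<lambda>x. M *v x) -` S) X"
    using assms invertible_surj[of M] unfolding preserves_def
    by (metis inj_onI surj_image_vimage_eq)
  moreover have "(\<lambda>S. (\<lambda>x. M *v x) -` S) ` X \<subseteq> X"
    using assms by (auto simp: preserves_def)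
  ultimately show ?thesis
    by (simp add: bij_betw_def endo_inj_surj)
qed

lemma family_sign_mult:
  assumes "preserves X M" "preserves X N"
  shows "family_sign X (M ** N) = family_sign X M * family_sign X N"
proof -
  have "family_sign X (M ** N)
      = sign_on X ((\<lambda>S. (\<lambda>x. N *v x) -` S) \<circ> (\<lambda>S. (\<lambda>x. M *v x) -` S))"
    by (simp add: family_sign_def vimage_def matrix_vector_mul_assoc o_def)
  also have "\<dots> = family_sign X N * family_sign X M"
    unfolding family_sign_def
    using assms by (intro sign_on_compose preserves_bij) auto
  finally show ?thesis
    by simp
qed

lemma family_sign_1 [simp]: "family_sign X (mat 1) = 1"
  by (simp add: family_sign_def)

lemma abs_family_sign: "\<bar>family_sign X M\<bar> = 1"
  by (simp add: family_sign_def sign_on_def)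

lemma matrix_group_simps [simp]:
  "carrier (matrix_group M) = M" "x \<otimes>\<^bsub>matrix_group M\<^esub> y = x ** y" "\<one>\<^bsub>matrix_group M\<^esub> = mat 1"
  by (simp_all add: matrix_group_def)

lemma matrix_group_groupI:
  assumes "mat 1 \<in> M" "\<And>A B. A \<in> M \<Longrightarrow> B \<in> M \<Longrightarrow> A ** B \<in> M"
    and "\<And>A. A \<in> M \<Longrightarrow> \<exists>B\<in>M. B ** A = mat 1"
  shows "group (matrix_group M)"
  by (rule groupI) (use assms in \<open>auto simp: matrix_mul_assoc\<close>)

lemma residue_matrix_invertible:
  assumes "group (matrix_group M)" "M \<subseteq> matrices_over ring_Q_sqrt_neg7" "A \<in> M"
  shows "invertible (residue_matrix c A)"
proof -
  interpret group "matrix_group M" by fact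
  obtain B where B: "B \<in> M" "A ** B = mat 1" "B ** A = mat 1"
    using assms(3) inv_closed l_inv r_inv by fastforce
  then show ?thesis
    using assms(2,3) residue_matrix_mult[of A B c] residue_matrix_mult[of B A c]
    unfolding invertible_def by (metis subsetD residue_matrix_1)
qed

text \<open>
  The two sign characters are those of the two reductions, \<open>c = 0\<close> and \<open>c = 1\<close>.
  The assumptions on \<open>g\<close> are those of a one-parameter family whose reduction depends only on
  the residue of the parameter. Since \<open>\<omega>\<close> has residues \<open>0, 1\<close> and
  \<open>1 - \<omega>\<close> has residues \<open>1, 0\<close>, the elements \<open>g \<omega>\<close> and
  \<open>g (1 - \<omega>)\<close> separate the characters.
\<close>
lemma matrix_group_no_single_normal_generator:
  fixes M :: "(complex^'n^'n) set" and g :: "complex \<Rightarrow> complex^'n^'n"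
  defines "G \<equiv> matrix_group M"
  assumes "group G"
    and over: "M \<subseteq> matrices_over ring_Q_sqrt_neg7"
    and inv: "\<And>A c. A \<in> M \<Longrightarrow> preserves X (residue_matrix c A)"
    and g: "\<And>t. t \<in> ring_Q_sqrt_neg7 \<Longrightarrow> g t \<in> M"
    and even: "\<And>t c. t \<in> ring_Q_sqrt_neg7 \<Longrightarrow> residue c t = 0 \<Longrightarrow> residue_matrix c (g t) = mat 1"
    and odd: "\<And>t c. t \<in> ring_Q_sqrt_neg7 \<Longrightarrow> residue c t = 1 \<Longrightarrow> family_sign X (residue_matrix c (g t)) = -1"
  shows "\<not> generated_by_conj_class G" "Delta 1 G = -\<infinity>"
proof -
  define h where "h c A = family_sign X (residue_matrix c A)" for c A
  have mult: "h c (A \<otimes>\<^bsub>G\<^esub> B) = h c A * h c B" if "A \<in> carrier G" "B \<in> carrier G" for A B c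
    using that over inv unfolding h_def G_def
    by (simp add: matrix_group_def subset_iff residue_matrix_mult family_sign_mult)
  have vals: "\<bar>h c A\<bar> = 1" for c A
    by (simp add: h_def abs_family_sign)
  have omega: "1 - omega \<in> ring_Q_sqrt_neg7" "residue c (1 - omega) = 1 - c" for c
  proof -
    show "1 - omega \<in> ring_Q_sqrt_neg7"
      by (intro ring_diff ring_one ring_omega)
    show "residue c (1 - omega) = 1 - c"
      using residue_coordinates[of c 1 "-1"] by simp
  qed
  have carrier: "g omega \<in> carrier G" "g (1 - omega) \<in> carrier G"
    using g ring_omega omega by (auto simp: G_def matrix_group_def)
  have "h 0 (g omega) = 1" "h 1 (g omega) = -1" "h 0 (g (1 - omega)) = -1" "h 1 (g (1 - omega)) = 1"
    unfolding h_def by (simp_all add: even odd ring_omega omega)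
  then have "\<exists>N. N \<lhd> G \<and> a \<in> N \<and> N \<noteq> carrier G" if "a \<in> carrier G" for a
    using proper_normal_subgroup_containing
        [of G "h 0" "h 1" "g (1 - omega)" "g omega" a, OF \<open>group G\<close> mult mult vals vals] carrier that
    by metis
  then show "\<not> generated_by_conj_class G" "Delta 1 G = -\<infinity>"
    using no_single_normal_generator[OF \<open>group G\<close>] by blast+
qed

section \<open>Elliptic quadratic forms and the symplectic group\<close>

definition sympl :: "'a::comm_ring_1^4 \<Rightarrow> 'a^4 \<Rightarrow> 'a" where
  "sympl x y = x $ 1 * y $ 3 - x $ 3 * y $ 1 + x $ 2 * y $ 4 - x $ 4 * y $ 2"

lemma vector_4:
  "(vector [a, b, c, d] :: 'a::zero^4) $ 1 = a" "(vector [a, b, c, d] :: 'a^4) $ 2 = b"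
  "(vector [a, b, c, d] :: 'a^4) $ 3 = c" "(vector [a, b, c, d] :: 'a^4) $ 4 = d"
  unfolding vector_def by simp_all

lemma sympl_matrix: "sympl x y = (\<Sum>i\<in>UNIV. x $ i * (sympl_form *v y) $ i)"
  by (simp add: sympl_def sympl_form_def matrix_vector_mult_def sum_4 vector_4)

lemma sum_matrix_vector_transpose:
  fixes A :: "'a::comm_ring_1^'n^'m"
  shows "(\<Sum>i\<in>UNIV. (A *v x) $ i * y $ i) = (\<Sum>j\<in>UNIV. x $ j * (transpose A *v y) $ j)"
  unfolding matrix_vector_mult_def transpose_def
  by (simp add: sum_distrib_left sum_distrib_right mult_ac) (rule sum.swap)

lemma sympl_invariant:
  assumes "transpose A ** sympl_form ** A = sympl_form"
  shows "sympl (A *v x) (A *v y) = sympl x y"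
proof -
  have "sympl (A *v x) (A *v y) = (\<Sum>j\<in>UNIV. x $ j * (transpose A *v (sympl_form *v (A *v y))) $ j)"
    by (simp only: sympl_matrix sum_matrix_vector_transpose)
  also have "transpose A *v (sympl_form *v (A *v y)) = (transpose A ** sympl_form ** A) *v y"
    by (simp add: matrix_vector_mul_assoc matrix_mul_assoc)
  finally show ?thesis
    by (simp add: assms sympl_matrix)
qed

lemma group_Sp4: "group (Sp4 ring_Q_sqrt_neg7)"
  unfolding Sp4_def
proof (rule matrix_group_groupI; (elim CollectE conjE)?)
  show "mat 1 \<in> {A \<in> matrices_over ring_Q_sqrt_neg7. transpose A ** sympl_form ** A = sympl_form}"
    by (simp add: matrices_over_ring_1)
next
  fix A B :: "complex^4^4"
  assume A: "A \<in> matrices_over ring_Q_sqrt_neg7" "transpose A ** sympl_form ** A = sympl_form"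
    and B: "B \<in> matrices_over ring_Q_sqrt_neg7" "transpose B ** sympl_form ** B = sympl_form"
  have "transpose (A ** B) ** sympl_form ** (A ** B)
      = transpose B ** (transpose A ** sympl_form ** A) ** B"
    by (simp add: matrix_transpose_mul matrix_mul_assoc)
  then show "A ** B \<in> {A \<in> matrices_over ring_Q_sqrt_neg7. transpose A ** sympl_form ** A = sympl_form}"
    using A B by (simp add: matrices_over_ring_mult)
next
  fix A :: "complex^4^4"
  assume A: "A \<in> matrices_over ring_Q_sqrt_neg7" "transpose A ** sympl_form ** A = sympl_form"
  define B where "B = - sympl_form ** transpose A ** sympl_form"
  (* The inverse is minus J times the transpose times J, where J is the matrix of the form. *)
  have sq: "- sympl_form ** sympl_form = mat 1"
    by (simp add: sympl_form_def matrix_matrix_mult_def vec_eq_iff forall_4 sum_4 vector_4 mat_def)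
  have BA: "B ** A = mat 1"
    unfolding B_def using A(2) sq by (simp add: matrix_mul_assoc[symmetric])
  then have AB: "A ** B = mat 1"
    by (simp add: matrix_left_right_inverse)
  have "sympl_form \<in> matrices_over ring_Q_sqrt_neg7"
    by (simp add: matrices_over_def forall_4 sympl_form_def vector_4 ring_zero ring_one ring_minus)
  then have "B \<in> matrices_over ring_Q_sqrt_neg7"
    unfolding B_def using A(1)
    by (intro matrices_over_ring_mult) (auto simp: matrices_over_def transpose_def ring_minus)
  moreover have "transpose B ** sympl_form ** B
      = transpose (A ** B) ** sympl_form ** (A ** B)"
    using A(2) by (simp add: matrix_transpose_mul matrix_mul_assoc[symmetric]) (simp add: matrix_mul_assoc)
  ultimately show "\<exists>B\<in>{A \<in> matrices_over ring_Q_sqrt_neg7. transpose A ** sympl_form ** A = sympl_form}. B ** A = mat 1"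
    using BA AB by auto
qed

definition polarises :: "(2^4 \<Rightarrow> 2) \<Rightarrow> bool" where
  "polarises q \<longleftrightarrow> (\<forall>x y. q (x + y) = q x + q y + sympl x y)"

text \<open>
  A function with values in \<open>F\<^sub>2\<close> is determined by its zeros, so that quadratic forms can
  be represented by their zero sets. A form with nondegenerate polarisation on
  \<open>F\<^sub>2\<^sup>4\<close> has six zeros if it is elliptic and ten if it is hyperbolic. Counting
  zeros makes it evident that the symplectic group preserves the elliptic forms.
\<close>
definition elliptic_quadrics :: "(2^4) set set" where
  "elliptic_quadrics = {S. card S = 6 \<and> (\<exists>q. polarises q \<and> S = {x. q x = 0})}"

lemma preserves_elliptic_quadrics:
  assumes "invertible M" "\<And>x y. sympl (M *v x) (M *v y) = sympl x y"
  shows "preserves elliptic_quadrics M"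
  unfolding preserves_def elliptic_quadrics_def
proof (intro conjI ballI assms(1); clarify; intro CollectI conjI exI)
  fix q :: "2^4 \<Rightarrow> 2"
  assume "card {x. q x = 0} = 6" and q: "polarises q"
  then show "card ((\<lambda>x. M *v x) -` {x. q x = 0}) = 6"
    by (simp only: invertible_card_vimage[OF assms(1)])
  show "polarises (\<lambda>x. q (M *v x))"
    using q assms(2) by (simp add: polarises_def matrix_vector_right_distrib)
qed auto

definition quad_form :: "2^4 \<Rightarrow> 2^4 \<Rightarrow> 2" where
  "quad_form a x = (\<Sum>i\<in>UNIV. a $ i * x $ i) + x $ 1 * x $ 3 + x $ 2 * x $ 4"

text \<open>
  A quadratic form is determined by its polarisation and its values on a basis.
\<close>
lemma polarises_imp_quad_form:
  assumes "polarises q"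
  obtains a where "q = quad_form a"
proof -
  define a where "a = (\<chi> i. q (axis i 1))"
  have add: "q (x + y) = q x + q y + sympl x y" for x y
    using assms by (simp add: polarises_def)
  have zero: "q 0 = 0"
    using add[of 0 0] by (simp add: sympl_def)
  have scale: "q (axis i c) = a $ i * c" for i c
    using F2_cases[of c] zero by (auto simp: a_def axis_def zero_vec_def[symmetric])
  have "q x = quad_form a x" for x
  proof -
    have "x = axis 1 (x $ 1) + (axis 2 (x $ 2) + (axis 3 (x $ 3) + axis 4 (x $ 4)))"
      by (simp add: vec_eq_iff forall_4 axis_def)
    then have "q x = q (axis 1 (x $ 1) + (axis 2 (x $ 2) + (axis 3 (x $ 3) + axis 4 (x $ 4))))"
      by simp
    then show ?thesis
      by (simp only: add scale) (simp add: quad_form_def sum_4 sympl_def axis_def algebra_simps)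
  qed
  then show ?thesis
    using that by blast
qed

text \<open>
  The expression \<open>a\<^sub>1 a\<^sub>3 + a\<^sub>2 a\<^sub>4\<close> is the Arf invariant of the form,
  computed in the symplectic basis; the form is elliptic iff it equals 1.
\<close>
lemma card_zeros_quad_form:
  "card {x. quad_form a x = 0} = (if a $ 1 * a $ 3 + a $ 2 * a $ 4 = 1 then 6 else 10)"
proof -
  have bij: "bij_betw (\<lambda>(p, q, r, s). vector [p, q, r, s] :: 2^4) UNIV UNIV"
  proof (rule bij_betwI[where g = "\<lambda>x. (x $ 1, x $ 2, x $ 3, x $ 4)"])
  qed (auto simp: vec_eq_iff forall_4 vector_4)
  have "card {x. quad_form a x = 0} = (\<Sum>x\<in>UNIV. of_bool (quad_form a x = 0))"
    by (simp add: sum.If_cases of_bool_def)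
  also have "\<dots> = (\<Sum>(p, q, r, s)\<in>UNIV. of_bool (quad_form a (vector [p, q, r, s]) = 0))"
    by (subst sum.reindex_bij_betw[OF bij, symmetric]) (simp add: case_prod_unfold)
  also have "\<dots> = (\<Sum>p\<in>UNIV. \<Sum>q\<in>UNIV. \<Sum>r\<in>UNIV. \<Sum>s\<in>UNIV.
      of_bool (quad_form a (vector [p, q, r, s]) = 0))"
    by (simp only: sum.cartesian_product UNIV_Times_UNIV)
  also have "\<dots> = (if a $ 1 * a $ 3 + a $ 2 * a $ 4 = 1 then 6 else 10)"
    using F2_cases[of "a $ 1"] F2_cases[of "a $ 2"] F2_cases[of "a $ 3"] F2_cases[of "a $ 4"]
    by (elim disjE) (simp_all add: quad_form_def sum_4 vector_4 sum_2)
  finally show ?thesis .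
qed

lemma elliptic_quadrics_eq:
  "elliptic_quadrics = (\<lambda>a. {x. quad_form a x = 0}) ` {a. a $ 1 * a $ 3 + a $ 2 * a $ 4 = 1}"
proof -
  have "polarises (quad_form a)" for a
    by (simp add: polarises_def quad_form_def sum_4 sympl_def algebra_simps)
  then show ?thesis
    unfolding elliptic_quadrics_def
    by (auto elim!: polarises_imp_quad_form simp: card_zeros_quad_form split: if_splits)
qed

definition long_root_element :: "'a::comm_ring_1 \<Rightarrow> 'a^4^4" where
  "long_root_element t = (\<chi> i j. if i = 1 \<and> j = 3 then t else if i = j then 1 else 0)"

lemma long_root_element_mult_vec:
  "long_root_element t *v x = (\<chi> i. if i = 1 then x $ 1 + t * x $ 3 else x $ i)"
  by (simp add: long_root_element_def matrix_vector_mult_def vec_eq_iff forall_4 sum_4)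

text \<open>
  The transvection adds the third coordinate to the first one. On the coefficients of a quadratic form this
  adds \<open>a\<^sub>1 + 1\<close> to \<open>a\<^sub>3\<close>, so that the forms with
  \<open>a\<^sub>1 = 1\<close> are fixed. If \<open>a\<^sub>1 = 0\<close>, then the Arf invariant is 1 only
  for \<open>a\<^sub>2 = a\<^sub>4 = 1\<close>; the two forms with these coefficients are exchanged.
\<close>
lemma family_sign_transvection: "family_sign elliptic_quadrics (long_root_element 1) = -1"
proof -
  define Z where "Z a = {x. quad_form a x = 0}" for a
  define flip :: "2^4 \<Rightarrow> 2^4" where "flip a = (\<chi> i. if i = 3 then a $ 3 + a $ 1 + 1 else a $ i)" for a
  have vimage: "(\<lambda>x. long_root_element 1 *v x) -` Z a = Z (flip a)" for a
  proof -
    have "quad_form a (long_root_element 1 *v x) = quad_form (flip a) x" for x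
      using F2_cases[of "x $ 3"]
      by (auto simp: quad_form_def long_root_element_mult_vec sum_4 flip_def algebra_simps)
    then show ?thesis
      by (simp add: Z_def)
  qed
  define P Q :: "2^4" where "P = vector [0, 1, 0, 1]" and "Q = vector [0, 1, 1, 1]"
  have mem: "axis i 1 \<in> Z a \<longleftrightarrow> a $ i = 0" for i a
    using exhaust_4[of i] by (auto simp: Z_def quad_form_def sum_4 axis_def)
  have ne: "Z a \<noteq> Z b" if "a $ i \<noteq> b $ i" for a b i
    using mem[of i a] mem[of i b] that F2_cases[of "a $ i"] F2_cases[of "b $ i"] by auto
  have "(\<lambda>x. long_root_element 1 *v x) -` Z a = Transposition.transpose (Z P) (Z Q) (Z a)"
    if a: "a $ 1 * a $ 3 + a $ 2 * a $ 4 = 1" for a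
  proof (cases "a $ 1 = 0")
    case True
    then have "a $ 2 = 1" "a $ 4 = 1"
      using a F2_cases[of "a $ 2"] F2_cases[of "a $ 4"] by auto
    then have "a = P \<and> flip a = Q \<or> a = Q \<and> flip a = P"
      using True F2_cases[of "a $ 3"]
      by (auto simp: P_def Q_def flip_def vec_eq_iff forall_4 vector_4)
    then show ?thesis
      unfolding vimage by auto
  next
    case False
    then have "flip a = a" "a $ 1 \<noteq> P $ 1" "a $ 1 \<noteq> Q $ 1"
      using F2_cases[of "a $ 1"]
      by (auto simp: P_def Q_def flip_def vec_eq_iff forall_4 vector_4)
    then show ?thesis
      unfolding vimage by (metis ne transpose_apply_other)
  qed
  then have "family_sign elliptic_quadrics (long_root_element 1)
      = sign_on elliptic_quadrics (Transposition.transpose (Z P) (Z Q))"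
    unfolding family_sign_def
    by (intro sign_on_cong) (auto simp: elliptic_quadrics_eq Z_def)
  also have "\<dots> = -1"
  proof (rule sign_on_transpose)
    show "Z P \<in> elliptic_quadrics" "Z Q \<in> elliptic_quadrics"
      unfolding elliptic_quadrics_eq Z_def by (auto simp: P_def Q_def vector_4)
    show "Z P \<noteq> Z Q"
      by (rule ne[of _ 3]) (simp add: P_def Q_def vector_4)
  qed
  finally show ?thesis .
qed

lemma residue_sympl:
  assumes "\<And>i. x $ i \<in> ring_Q_sqrt_neg7" "\<And>i. y $ i \<in> ring_Q_sqrt_neg7"
  shows "residue c (sympl x y) = sympl (residue_vec c x) (residue_vec c y)"
  using assms
  by (simp add: sympl_def residue_vec_def residue_diff ring_mult ring_add ring_diff del: F2_minus)

lemma Sp4_no_single_normal_generator: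
  "\<not> generated_by_conj_class (Sp4 ring_Q_sqrt_neg7)" "Delta 1 (Sp4 ring_Q_sqrt_neg7) = -\<infinity>"
proof -
  define M :: "(complex^4^4) set"
    where "M = {A \<in> matrices_over ring_Q_sqrt_neg7. transpose A ** sympl_form ** A = sympl_form}"
  have Sp4: "Sp4 ring_Q_sqrt_neg7 = matrix_group M"
    by (simp add: Sp4_def M_def)
  have over: "M \<subseteq> matrices_over ring_Q_sqrt_neg7"
    by (auto simp: M_def)
  have elements: "long_root_element t \<in> M" if "t \<in> ring_Q_sqrt_neg7" for t
    using that
    by (simp add: M_def matrices_over_def long_root_element_def ring_one ring_zero)
      (simp add: vec_eq_iff forall_4 sum_4 matrix_matrix_mult_def transpose_def sympl_form_def vector_4)
  have group: "group (matrix_group M)"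
    using group_Sp4 by (simp add: Sp4)
  have inv: "preserves elliptic_quadrics (residue_matrix c A)" if A: "A \<in> M" for A c
  proof (rule preserves_elliptic_quadrics)
    show "invertible (residue_matrix c A)"
      using residue_matrix_invertible[OF group over A] .
  next
    fix x y :: "2^4"
    have "sympl (A *v lift_vec x) (A *v lift_vec y) = sympl (lift_vec x) (lift_vec y)"
      using A by (simp add: M_def sympl_invariant)
    then have "residue c (sympl (A *v lift_vec x) (A *v lift_vec y))
        = residue c (sympl (lift_vec x) (lift_vec y))"
      by simp
    then show "sympl (residue_matrix c A *v x) (residue_matrix c A *v y) = sympl x y"
      using A over
      by (simp add: subset_iff residue_sympl residue_matrix_vector_mult lift_vec_ring matrix_vector_mult_ring)
  qed
  have residue: "residue_matrix c (long_root_element t) = long_root_element (residue c t)" for c t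
    by (auto simp: residue_matrix_def long_root_element_def vec_eq_iff)
  have "long_root_element 0 = mat 1"
    by (auto simp: long_root_element_def mat_def vec_eq_iff)
  then have even: "residue_matrix c (long_root_element t) = mat 1" if "residue c t = 0" for c t
    using that by (simp add: residue)
  have odd: "family_sign elliptic_quadrics (residue_matrix c (long_root_element t)) = -1"
    if "residue c t = 1" for c t
    using that by (simp add: residue family_sign_transvection)
  show "\<not> generated_by_conj_class (Sp4 ring_Q_sqrt_neg7)" "Delta 1 (Sp4 ring_Q_sqrt_neg7) = -\<infinity>"
    unfolding Sp4
    by (rule matrix_group_no_single_normal_generator[OF group over inv elements even odd]; assumption)+
qed

section \<open>Density of the integral points of a Chevalley group\<close>

lemma int_poly_sum:
  "(\<And>i. i \<in> I \<Longrightarrow> f i \<in> int_poly_funs) \<Longrightarrow> (\<lambda>A. \<Sum>i\<in>I. f i A) \<in> int_poly_funs"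
  by (induction I rule: infinite_finite_induct)
    (use int_poly_funs.const[of 0] in \<open>auto intro: int_poly_funs.add\<close>)

lemma int_poly_prod:
  "(\<And>i. i \<in> I \<Longrightarrow> f i \<in> int_poly_funs) \<Longrightarrow> (\<lambda>A. \<Prod>i\<in>I. f i A) \<in> int_poly_funs"
  by (induction I rule: infinite_finite_induct)
    (use int_poly_funs.const[of 1] in \<open>auto intro: int_poly_funs.mult\<close>)

lemma int_poly_diff:
  assumes "f \<in> int_poly_funs" "g \<in> int_poly_funs"
  shows "(\<lambda>A. f A - g A) \<in> int_poly_funs"
  using int_poly_funs.add[OF assms(1) int_poly_funs.mult[OF int_poly_funs.const[of "-1"] assms(2)]]
  by simp

lemma int_poly_compose:
  assumes "f \<in> int_poly_funs" "\<And>i j. (\<lambda>A. F A $ i $ j) \<in> int_poly_funs"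
  shows "(\<lambda>A. f (F A)) \<in> int_poly_funs"
  using assms(1) by induction (auto intro: int_poly_funs.intros assms(2))

lemma int_poly_Ints_const:
  assumes "z \<in> \<int>"
  shows "(\<lambda>A. z) \<in> int_poly_funs"
  using assms int_poly_funs.const by (auto elim: Ints_cases)

lemma int_poly_mult_right:
  assumes "f \<in> int_poly_funs" "Y \<in> matrices_over \<int>"
  shows "(\<lambda>A. f (A ** Y)) \<in> int_poly_funs"
  by (rule int_poly_compose[OF assms(1)])
    (use assms(2) in \<open>auto simp: matrix_matrix_mult_def matrices_over_def
      intro!: int_poly_sum int_poly_funs.mult int_poly_funs.entry int_poly_Ints_const\<close>)

lemma int_poly_mult_left:
  assumes "f \<in> int_poly_funs" "Y \<in> matrices_over \<int>"
  shows "(\<lambda>A. f (Y ** A)) \<in> int_poly_funs"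
  by (rule int_poly_compose[OF assms(1)])
    (use assms(2) in \<open>auto simp: matrix_matrix_mult_def matrices_over_def
      intro!: int_poly_sum int_poly_funs.mult int_poly_funs.entry int_poly_Ints_const\<close>)

lemma int_poly_value_Ints:
  assumes "f \<in> int_poly_funs" "Y \<in> matrices_over \<int>"
  shows "f Y \<in> \<int>"
  using assms(1) by induction (use assms(2) in \<open>auto simp: matrices_over_def\<close>)

lemma int_poly_value_ring:
  assumes "f \<in> int_poly_funs" "A \<in> matrices_over ring_Q_sqrt_neg7"
  shows "f A \<in> ring_Q_sqrt_neg7"
  using assms(1) by induction
    (use assms(2) in \<open>auto simp: matrices_over_def ring_of_int ring_add ring_mult\<close>)

lemma int_poly_det:
  assumes "\<And>i j. (\<lambda>A. F A $ i $ j) \<in> int_poly_funs"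
  shows "(\<lambda>A. det (F A)) \<in> int_poly_funs"
  unfolding det_def
  by (intro int_poly_sum int_poly_funs.mult int_poly_funs.const int_poly_prod assms)

text \<open>
  With \<open>1, \<omega>\<close> as a basis of the ring over \<open>\<int>\<close>, multiplication by a
  fixed matrix over the ring becomes a pair of integral polynomial maps. This is how relations over the ring
  are reduced to integral ones.
\<close>
lemma int_poly_split:
  fixes A :: "complex^'n^'n"
  assumes "f \<in> int_poly_funs" "A \<in> matrices_over ring_Q_sqrt_neg7"
  obtains g h where "g \<in> int_poly_funs" "h \<in> int_poly_funs"
    "\<And>Y. f (A ** Y) = g Y + h Y * omega"
proof -
  define splits where "splits f \<longleftrightarrow> (\<exists>g h. g \<in> int_poly_funs \<and> h \<in> int_poly_funs \<and>
      (\<forall>Y. f (A ** Y) = g Y + h Y * omega))" for f :: "complex^'n^'n \<Rightarrow> complex"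
  have splitsI: "splits f"
    if "g \<in> int_poly_funs" "h \<in> int_poly_funs" "\<And>Y. f (A ** Y) = g Y + h Y * omega" for f g h
    using that unfolding splits_def by blast
  have "splits f"
    using assms(1)
  proof induction
    case (const c)
    show ?case
      by (rule splitsI[of "\<lambda>Y. of_int c" "\<lambda>Y. of_int 0"]) (simp_all only: int_poly_funs.const, simp)
  next
    case (entry i j)
    have "\<forall>k. \<exists>a b. A $ i $ k = of_int a + of_int b * omega"
      using assms(2) by (auto simp: matrices_over_def ring_Q_sqrt_neg7_eq)
    then obtain a b where ab: "\<And>k. A $ i $ k = of_int (a k) + of_int (b k) * omega"
      by metis
    show ?case
    proof (rule splitsI)
      show "(A ** Y) $ i $ j = (\<Sum>k\<in>UNIV. of_int (a k) * Y $ k $ j)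
          + (\<Sum>k\<in>UNIV. of_int (b k) * Y $ k $ j) * omega" for Y
        by (simp add: matrix_matrix_mult_def ab algebra_simps sum.distrib sum_distrib_left)
    qed (intro int_poly_sum int_poly_funs.intros)+
  next
    case (add f f')
    then obtain g h g' h' where
      gh: "g \<in> int_poly_funs" "h \<in> int_poly_funs" "\<And>Y. f (A ** Y) = g Y + h Y * omega" and
      gh': "g' \<in> int_poly_funs" "h' \<in> int_poly_funs" "\<And>Y. f' (A ** Y) = g' Y + h' Y * omega"
      unfolding splits_def by metis
    show ?case
      by (rule splitsI[OF int_poly_funs.add[OF gh(1) gh'(1)] int_poly_funs.add[OF gh(2) gh'(2)]])
        (simp add: gh(3) gh'(3) algebra_simps)
  next
    case (mult f f')
    then obtain g h g' h' where
      gh: "g \<in> int_poly_funs" "h \<in> int_poly_funs" "\<And>Y. f (A ** Y) = g Y + h Y * omega" and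
      gh': "g' \<in> int_poly_funs" "h' \<in> int_poly_funs" "\<And>Y. f' (A ** Y) = g' Y + h' Y * omega"
      unfolding splits_def by metis
    show ?case
    proof (rule splitsI)
      show "(\<lambda>Y. g Y * g' Y - of_int 2 * (h Y * h' Y)) \<in> int_poly_funs"
        "(\<lambda>Y. g Y * h' Y + h Y * g' Y + h Y * h' Y) \<in> int_poly_funs"
        by (intro int_poly_diff int_poly_funs.intros gh gh')+
      fix Y
      have "f (A ** Y) * f' (A ** Y)
          = g Y * g' Y + (g Y * h' Y + h Y * g' Y) * omega + h Y * h' Y * (omega * omega)"
        by (simp add: gh(3) gh'(3) algebra_simps)
      then show "f (A ** Y) * f' (A ** Y) = g Y * g' Y - of_int 2 * (h Y * h' Y)
          + (g Y * h' Y + h Y * g' Y + h Y * h' Y) * omega"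
        unfolding omega_mult_self by (simp add: algebra_simps)
    qed
  qed
  then show ?thesis
    using that unfolding splits_def by blast
qed

text \<open>
  These hypotheses make \<^const>\<open>root_element\<close> the exponential map and ensure that root
  elements with parameters in a ring have entries in that ring.
\<close>
locale integral_root_vectors =
  fixes \<X> :: "(complex^'n^'n) set"
  assumes cube: "X \<in> \<X> \<Longrightarrow> X ** X ** X = 0"
    and integral: "X \<in> \<X> \<Longrightarrow> X $ i $ j \<in> \<int>"
    and half_square_integral: "X \<in> \<X> \<Longrightarrow> (X ** X) $ i $ j / 2 \<in> \<int>"

lemma root_element_add:
  assumes "X ** X ** X = 0"
  shows "root_element X s ** root_element X t = root_element X (s + t)"
proof -
  define sc :: "complex \<Rightarrow> complex^'a^'a \<Rightarrow> complex^'a^'a" where "sc c A = (\<chi> i j. c * A $ i $ j)" for c A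
  have sc: "sc c A ** B = sc c (A ** B)" "A ** sc c B = sc c (A ** B)" "sc c (sc d A) = sc (c * d) A"
    "sc c (A + B) = sc c A + sc c B" "sc c 0 = 0" for c d A B
    by (simp_all add: sc_def matrix_matrix_mult_def vec_eq_iff sum_distrib_left algebra_simps)
  have root: "root_element X t = mat 1 + sc t X + sc (t\<^sup>2 / 2) (X ** X)" for t
    by (simp add: root_element_def sc_def vec_eq_iff)
  have "X ** (X ** X) = 0" "X ** X ** (X ** X) = 0"
    using assms by (simp_all add: matrix_mul_assoc)
  then have "root_element X s ** root_element X t
      = mat 1 + sc t X + sc (t\<^sup>2 / 2) (X ** X) + (sc s X + sc (s * t) (X ** X)) + sc (s\<^sup>2 / 2) (X ** X)"
    using assms by (simp add: root matrix_mult_distribs sc mult.commute)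
  also have "\<dots> = root_element X (s + t)"
    unfolding root by (simp add: sc_def vec_eq_iff power2_eq_square field_simps)
  finally show ?thesis .
qed

lemma root_element_0 [simp]: "root_element X 0 = mat 1"
  by (simp add: root_element_def vec_eq_iff)

lemma group_GL: "group (GL :: (complex^'n^'n) monoid)"
  unfolding GL_def
proof (rule matrix_group_groupI)
  show "\<exists>B\<in>{A. invertible A}. B ** A = mat 1" if "A \<in> {A. invertible A}" for A :: "complex^'n^'n"
    using that by (auto simp: invertible_def)
  show "mat 1 \<in> {A :: complex^'n^'n. invertible A}"
    by (auto simp: invertible_def intro: exI[of _ "mat 1"])
qed (simp add: invertible_mult)

lemma GL_inverse:
  fixes A B :: "complex^'n^'n"
  assumes "A ** B = mat 1"
  shows "A \<in> carrier GL" "inv\<^bsub>GL\<^esub> A = B"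
proof -
  interpret GL: group "GL :: (complex^'n^'n) monoid" by (rule group_GL)
  have "B ** A = mat 1"
    using assms by (simp add: matrix_left_right_inverse)
  then have AB: "A \<in> carrier GL" "B \<in> carrier GL" "B ** A = mat 1"
    using assms by (auto simp: GL_def invertible_def)
  then show "A \<in> carrier GL" "inv\<^bsub>GL\<^esub> A = B"
    by (auto simp: GL_def intro!: GL.inv_equality[unfolded GL_def])
qed

context integral_root_vectors
begin

inductive_set integral_products :: "(complex^'n^'n) set" where
  one: "mat 1 \<in> integral_products"
| step: "X \<in> \<X> \<Longrightarrow> Y \<in> integral_products \<Longrightarrow> root_element X (of_int n) ** Y \<in> integral_products"

lemma root_element_inverse:
  assumes "X \<in> \<X>"
  shows "root_element X t ** root_element X (-t) = mat 1" "root_element X (-t) ** root_element X t = mat 1"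
  using assms by (simp_all add: root_element_add cube)

lemma root_elements_GL: "{root_element X t | X t. X \<in> \<X>} \<subseteq> carrier GL"
  using root_element_inverse(1) by (auto intro: GL_inverse(1))

lemma root_element_in_group: "X \<in> \<X> \<Longrightarrow> root_element X t \<in> complex_chevalley_group \<X>"
  unfolding complex_chevalley_group_def by (rule generate.incl) blast

lemma complex_chevalley_group_mult:
  "A \<in> complex_chevalley_group \<X> \<Longrightarrow> B \<in> complex_chevalley_group \<X> \<Longrightarrow> A ** B \<in> complex_chevalley_group \<X>"
  unfolding complex_chevalley_group_def using generate.eng[of A GL _ B] by (simp add: GL_def)

lemma complex_chevalley_group_1: "mat 1 \<in> complex_chevalley_group \<X>"
  unfolding complex_chevalley_group_def using generate.one[of GL] by (simp add: GL_def)

lemma complex_chevalley_group_inverse: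
  assumes "A \<in> complex_chevalley_group \<X>" "A ** B = mat 1"
  shows "B \<in> complex_chevalley_group \<X>"
proof -
  interpret GL: group "GL :: (complex^'n^'n) monoid" by (rule group_GL)
  have "inv\<^bsub>GL\<^esub> A \<in> generate GL {root_element X t | X t. X \<in> \<X>}"
    using assms(1) unfolding complex_chevalley_group_def
    by (rule GL.generate_m_inv_closed[OF root_elements_GL])
  then show ?thesis
    unfolding complex_chevalley_group_def by (simp only: GL_inverse(2)[OF assms(2)])
qed

lemma root_element_integral: "X \<in> \<X> \<Longrightarrow> root_element X (of_int n) \<in> matrices_over \<int>"
proof -
  assume X: "X \<in> \<X>"
  have "(of_int n)\<^sup>2 / 2 * (X ** X) $ i $ j = (of_int n)\<^sup>2 * ((X ** X) $ i $ j / 2)" for i j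
    by simp
  moreover have "(of_int n)\<^sup>2 * ((X ** X) $ i $ j / 2) \<in> \<int>" for i j
    using half_square_integral[OF X] by (intro Ints_mult Ints_power) auto
  ultimately show ?thesis
    using integral[OF X] by (auto simp: root_element_def matrices_over_def mat_def simp del: times_divide_eq_left times_divide_eq_right)
qed

lemma integral_products_integral: "Y \<in> integral_products \<Longrightarrow> Y \<in> matrices_over \<int>"
proof (induction rule: integral_products.induct)
  case one
  show ?case by (auto simp: matrices_over_def mat_def)
next
  case (step X Y n)
  then show ?case
    using root_element_integral[of X n]
    by (auto simp: matrices_over_def matrix_matrix_mult_def)
qed

lemma integral_products_in_group: "Y \<in> integral_products \<Longrightarrow> Y \<in> complex_chevalley_group \<X>"
  by (induction rule: integral_products.induct)
    (auto intro: complex_chevalley_group_1 complex_chevalley_group_mult root_element_in_group)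

lemma int_poly_on_root_subgroup:
  assumes "f \<in> int_poly_funs"
  obtains p where "\<And>t. f (root_element X t ** B) = poly p t"
proof -
  have "\<exists>p. \<forall>t. f (root_element X t ** B) = poly p t"
    using assms
  proof induction
    case (const c)
    show ?case by (intro exI[of _ "[:of_int c:]"]) simp
  next
    case (entry i j)
    show ?case
      by (intro exI[of _ "\<Sum>k\<in>UNIV. [:mat 1 $ i $ k, X $ i $ k, (X ** X) $ i $ k / 2:] * [:B $ k $ j:]"])
        (simp add: root_element_def matrix_matrix_mult_def[of _ B] poly_sum power2_eq_square algebra_simps)
  next
    case (add f g)
    then show ?case by (metis poly_add)
  next
    case (mult f g)
    then show ?case by (metis poly_mult)
  qed
  then show ?thesis
    using that by blast
qed

text \<open>
  For given \<open>B\<close>, the value of \<open>f\<close> at \<open>root_element X t ** B\<close> is a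
  polynomial in \<open>t\<close>, hence zero as soon as it vanishes at all integers. So the integral
  parameters can be replaced by complex ones, one factor after the other.
\<close>
lemma integral_products_dense:
  assumes f: "f \<in> int_poly_funs" "\<And>Y. Y \<in> integral_products \<Longrightarrow> f Y = 0"
    and C: "C \<in> complex_chevalley_group \<X>"
  shows "f C = 0"
proof -
  define V where "V = {B :: complex^'n^'n. \<forall>f\<in>int_poly_funs. (\<forall>Y\<in>integral_products. f Y = 0) \<longrightarrow> f B = 0}"
  have root: "root_element X t ** B \<in> V" if X: "X \<in> \<X>" and B: "B \<in> V" for X t B
    unfolding V_def
  proof (intro CollectI ballI impI)
    fix f :: "complex^'n^'n \<Rightarrow> complex"
    assume f: "f \<in> int_poly_funs" "\<forall>Y\<in>integral_products. f Y = 0"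
    obtain p where p: "\<And>t. f (root_element X t ** B) = poly p t"
      using int_poly_on_root_subgroup[OF f(1)] by blast
    (* At an integral parameter the root element can be absorbed into f. *)
    have "poly p (of_int n) = 0" for n
    proof -
      have "(\<lambda>A. f (root_element X (of_int n) ** A)) \<in> int_poly_funs"
        by (rule int_poly_mult_left[OF f(1) root_element_integral[OF X]])
      moreover have "\<forall>Y\<in>integral_products. f (root_element X (of_int n) ** Y) = 0"
        using f(2) X by (auto intro: integral_products.step)
      moreover have "g B = 0" if "g \<in> int_poly_funs" "\<forall>Y\<in>integral_products. g Y = 0" for g
        using B that by (simp add: V_def)
      ultimately have "f (root_element X (of_int n) ** B) = 0"
        by blast
      then show ?thesis
        by (simp add: p)
    qed
    then have "range of_int \<subseteq> {x :: complex. poly p x = 0}" by auto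
    moreover have "infinite (range (of_int :: int \<Rightarrow> complex))"
      by (simp add: finite_image_iff inj_on_def)
    ultimately have "p = 0"
      using poly_roots_finite[of p] finite_subset by blast
    then show "f (root_element X t ** B) = 0"
      by (simp add: p)
  qed
  have "\<forall>B\<in>V. C ** B \<in> V"
    using C unfolding complex_chevalley_group_def
  proof (induction rule: generate.induct)
    case one
    show ?case by (simp add: GL_def)
  next
    case (incl h)
    then show ?case using root by auto
  next
    case (inv h)
    then obtain X t where h: "h = root_element X t" "X \<in> \<X>" by auto
    have "inv\<^bsub>GL\<^esub> h = root_element X (-t)"
      unfolding h(1) by (rule GL_inverse(2)) (rule root_element_inverse(1)[OF h(2)])
    then show ?case using root h by auto
  next
    case (eng h1 h2)
    then show ?case by (auto simp: GL_def matrix_mul_assoc[symmetric])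
  qed
  moreover have "mat 1 \<in> V"
    by (auto simp: V_def intro: integral_products.one)
  ultimately have "C ** mat 1 \<in> V" by blast
  then show ?thesis
    using f by (auto simp: V_def)
qed

section \<open>The group of points of a Chevalley--Demazure scheme\<close>

definition points :: "(complex^'n^'n) set" where
  "points = {A \<in> matrices_over ring_Q_sqrt_neg7.
     \<forall>f\<in>int_poly_funs. (\<forall>B\<in>complex_chevalley_group \<X>. f B = 0) \<longrightarrow> f A = 0}"

lemma points_over_ring: "points \<subseteq> matrices_over ring_Q_sqrt_neg7"
  by (auto simp: points_def)

lemma points_vanish:
  assumes "A \<in> points" "f \<in> int_poly_funs" "\<And>C. C \<in> complex_chevalley_group \<X> \<Longrightarrow> f C = 0"
  shows "f A = 0"
  using assms by (simp add: points_def)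

text \<open>
  The closure is shown one factor at a time: first for the product of \<open>A\<close> with an integral
  matrix \<open>Y\<close> of the complex group, since then \<open>C \<mapsto> f (C Y)\<close> is an integral
  relation. For the second factor the relation \<open>Y \<mapsto> f (A Y)\<close> has coefficients in the
  ring, and is split into two integral ones.
\<close>
lemma points_mult:
  assumes A: "A \<in> points" and B: "B \<in> points"
  shows "A ** B \<in> points"
proof -
  have "f (A ** B) = 0" if f: "f \<in> int_poly_funs" "\<forall>C\<in>complex_chevalley_group \<X>. f C = 0" for f
  proof -
    have *: "f (A ** Y) = 0" if "Y \<in> integral_products" for Y
    proof -
      have "(\<lambda>C. f (C ** Y)) \<in> int_poly_funs"
        using f(1) that by (intro int_poly_mult_right integral_products_integral)
      then show ?thesis
        by (rule points_vanish[OF A])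
          (use f(2) that in \<open>auto intro: complex_chevalley_group_mult integral_products_in_group\<close>)
    qed
    obtain g h where gh: "g \<in> int_poly_funs" "h \<in> int_poly_funs"
      "\<And>Y. f (A ** Y) = g Y + h Y * omega"
      using int_poly_split[OF f(1)] A by (auto simp: points_def)
    have zero: "g Y = 0 \<and> h Y = 0" if Y: "Y \<in> integral_products" for Y
    proof -
      obtain m k where mk: "g Y = of_int m" "h Y = of_int k"
        using int_poly_value_Ints gh(1,2) integral_products_integral[OF Y] by (metis Ints_cases)
      then have "of_int m + of_int k * omega = of_int 0 + of_int 0 * omega"
        using *[OF Y] gh(3) by simp
      then have "m = 0" "k = 0"
        by (rule omega_coordinates_unique)+
      then show ?thesis
        using mk by simp
    qed
    have "g C = 0" if "C \<in> complex_chevalley_group \<X>" for C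
      by (rule integral_products_dense[OF gh(1) _ that]) (simp add: zero)
    then have "g B = 0"
      by (rule points_vanish[OF B gh(1)])
    have "h C = 0" if "C \<in> complex_chevalley_group \<X>" for C
      by (rule integral_products_dense[OF gh(2) _ that]) (simp add: zero)
    then have "h B = 0"
      by (rule points_vanish[OF B gh(2)])
    with \<open>g B = 0\<close> show ?thesis
      using gh(3) by simp
  qed
  then show ?thesis
    using A B by (auto simp: points_def matrices_over_ring_mult)
qed

text \<open>
  An integral root element has an integral inverse, so that its determinant is \<open>\<plusminus>1\<close>.
  That the square of the determinant is 1 is all that Cramer's rule needs in order to give a polynomial
  formula for the inverse, and it extends by density.
\<close>
lemma det_square: "C \<in> complex_chevalley_group \<X> \<Longrightarrow> det C * det C - 1 = 0"
proof (rule integral_products_dense)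
  show "(\<lambda>C. det C * det C - 1) \<in> int_poly_funs"
    using int_poly_funs.const[of 1]
    by (intro int_poly_diff int_poly_funs.mult int_poly_det int_poly_funs.entry) auto
next
  fix Y assume "Y \<in> integral_products"
  then show "det Y * det Y - 1 = 0"
  proof (induction rule: integral_products.induct)
    case one
    show ?case by simp
  next
    case (step X Y n)
    have "(\<lambda>C. det C) \<in> int_poly_funs"
      by (intro int_poly_det int_poly_funs.entry)
    then have "det (root_element X (of_int n)) \<in> \<int>" "det (root_element X (of_int (-n))) \<in> \<int>"
      using root_element_integral[OF step(1)] int_poly_value_Ints by blast+
    then obtain m k where mk: "det (root_element X (of_int n)) = of_int m"
      "det (root_element X (of_int (-n))) = of_int k"
      by (metis Ints_cases)
    have "of_int (m * k) = det (root_element X (of_int n) ** root_element X (of_int (-n)))"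
      by (simp only: det_mul mk of_int_mult)
    also have "\<dots> = (of_int 1 :: complex)"
      using root_element_inverse[OF step(1), of "of_int n"] by simp
    finally have "m * k = 1" by (simp only: of_int_eq_iff)
    then have "m * m = 1"
      by (auto simp: zmult_eq_1_iff)
    then have "(of_int m * of_int m :: complex) = 1"
      by (metis of_int_1 of_int_mult)
    moreover have "det Y * det Y = 1" using step by simp
    ultimately show ?case
      by (simp add: det_mul mk algebra_simps)
  qed
qed

text \<open>
  Cramer's rule, with the factor \<open>1 / det A\<close> replaced by \<open>det A\<close>: the result has
  integral polynomials in the entries of \<open>A\<close> as its entries and is the inverse if
  \<open>(det A)\<^sup>2 = 1\<close>.
\<close>
definition cramer_inverse :: "complex^'n^'n \<Rightarrow> complex^'n^'n" where
  "cramer_inverse A = (\<chi> i j. det A * det (\<chi> k l. if l = i then axis j 1 $ k else A $ k $ l))"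

lemma cramer_inverse:
  assumes "det A * det A = 1"
  shows "A ** cramer_inverse A = mat 1"
proof -
  have ne: "det A \<noteq> 0" using assms by auto
  have inv: "z / det A = det A * z" for z
  proof -
    have "z / det A = det A * det A * z / det A" by (simp only: assms mult_1)
    then show ?thesis using ne by simp
  qed
  have "A *v column j (cramer_inverse A) = axis j 1" for j
    unfolding cramer[OF ne] inv by (simp add: cramer_inverse_def column_def)
  then have "(A *v column j (cramer_inverse A)) $ i = axis j 1 $ i" for i j
    by simp
  then show ?thesis
    by (simp add: vec_eq_iff matrix_matrix_mult_def matrix_vector_mult_def column_def mat_def axis_def)
qed

lemma cramer_inverse_int_poly: "(\<lambda>A. cramer_inverse A $ i $ j) \<in> int_poly_funs"
proof -
  have "(\<lambda>A. (\<chi> k l. if l = i then axis j 1 $ k else A $ k $ l) $ k $ l) \<in> int_poly_funs" for k l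
    using int_poly_funs.const[of 0] int_poly_funs.const[of 1]
    by (cases "l = i"; cases "k = j") (auto simp: axis_def intro: int_poly_funs.entry)
  then show ?thesis
    by (simp add: cramer_inverse_def int_poly_det int_poly_funs.entry int_poly_funs.mult)
qed

lemma points_inverse:
  assumes A: "A \<in> points"
  shows "\<exists>B\<in>points. B ** A = mat 1"
proof
  have "(\<lambda>C. det C * det C - 1) \<in> int_poly_funs"
    using int_poly_funs.const[of 1]
    by (intro int_poly_diff int_poly_funs.mult int_poly_det int_poly_funs.entry) auto
  then have "det A * det A - 1 = 0"
    by (rule points_vanish[OF A]) (rule det_square)
  then have "det A * det A = 1"
    by simp
  then show "cramer_inverse A ** A = mat 1"
    using cramer_inverse matrix_left_right_inverse by blast
  have "f (cramer_inverse A) = 0"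
    if f: "f \<in> int_poly_funs" "\<forall>C\<in>complex_chevalley_group \<X>. f C = 0" for f
  proof -
    have "(\<lambda>C. f (cramer_inverse C)) \<in> int_poly_funs"
      using f(1) cramer_inverse_int_poly by (rule int_poly_compose)
    moreover have "f (cramer_inverse C) = 0" if "C \<in> complex_chevalley_group \<X>" for C
      using f(2) det_square[OF that] complex_chevalley_group_inverse[OF that] cramer_inverse[of C] by auto
    ultimately show ?thesis
      by (rule points_vanish[OF A])
  qed
  moreover have "cramer_inverse A \<in> matrices_over ring_Q_sqrt_neg7"
    using A int_poly_value_ring[OF cramer_inverse_int_poly] by (auto simp: matrices_over_def points_def)
  ultimately show "cramer_inverse A \<in> points"
    by (auto simp: points_def)
qed

lemma points_1: "mat 1 \<in> points"
  using complex_chevalley_group_1 by (auto simp: points_def matrices_over_ring_1)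

lemma group_points: "group (matrix_group points)"
  by (rule matrix_group_groupI[OF points_1 points_mult points_inverse])

lemma root_element_in_points:
  assumes X: "X \<in> \<X>" and t: "t \<in> ring_Q_sqrt_neg7"
  shows "root_element X t \<in> points"
proof -
  have "root_element X t $ i $ j \<in> ring_Q_sqrt_neg7" for i j
  proof -
    obtain a b where ab: "X $ i $ j = of_int a" "(X ** X) $ i $ j / 2 = of_int b"
      using integral[OF X] half_square_integral[OF X] by (metis Ints_cases)
    have "root_element X t $ i $ j = (if i = j then 1 else 0) + t * of_int a + t * t * of_int b"
      using ab by (simp add: root_element_def mat_def power2_eq_square field_simps)
    also have "\<dots> \<in> ring_Q_sqrt_neg7"
      using t by (simp add: ring_add ring_mult ring_of_int ring_one ring_zero)
    finally show ?thesis .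
  qed
  then show ?thesis
    using root_element_in_group[OF X] by (auto simp: points_def matrices_over_def)
qed

end

section \<open>The invariant alternating trilinear form of type \<open>G\<^sub>2\<close>\<close>

definition minor3 :: "7 \<Rightarrow> 7 \<Rightarrow> 7 \<Rightarrow> 'a::comm_ring_1^7 \<Rightarrow> 'a^7 \<Rightarrow> 'a^7 \<Rightarrow> 'a" where
  "minor3 i j k x y z =
     x $ i * (y $ j * z $ k - y $ k * z $ j)
     - x $ j * (y $ i * z $ k - y $ k * z $ i)
     + x $ k * (y $ i * z $ j - y $ j * z $ i)"

text \<open>
  Up to normalisation this is the form \<open>(x, y, z) \<mapsto> \<langle>x \<cdot> y, z\<rangle>\<close>
  given by the multiplication of octonions of trace zero. The nonzero coefficients occur at triples of
  weights with sum 0, and their signs are forced by the choice of the root vectors.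
\<close>
definition trilinear :: "'a::comm_ring_1^7 \<Rightarrow> 'a^7 \<Rightarrow> 'a^7 \<Rightarrow> 'a" where
  "trilinear x y z = minor3 0 1 6 x y z + minor3 0 2 5 x y z + minor3 0 4 3 x y z
     - minor3 1 2 4 x y z + minor3 6 5 3 x y z"

lemma forall_7: "(\<forall>i::7. P i) \<longleftrightarrow> P 0 \<and> P 1 \<and> P 2 \<and> P 3 \<and> P 4 \<and> P 5 \<and> P 6"
  by (metis exhaust_7)

lemma root_element_mult_vec:
  "root_element X t *v x = x + t *s (X *v x) + (t\<^sup>2 / 2) *s (X *v (X *v x))"
proof -
  have "(root_element X t *v x) $ i = (x + t *s (X *v x) + (t\<^sup>2 / 2) *s ((X ** X) *v x)) $ i" for i
  proof -
    have "(root_element X t *v x) $ i = (mat 1 *v x) $ i + t * (X *v x) $ i + t\<^sup>2 / 2 * ((X ** X) *v x) $ i"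
      unfolding root_element_def matrix_vector_mult_def
      by (simp add: sum.distrib sum_distrib_left algebra_simps)
    then show ?thesis by simp
  qed
  then show ?thesis
    by (simp add: vec_eq_iff matrix_vector_mul_assoc)
qed

lemma matrix_unit_mult_vec: "matrix_unit i j *v x = axis i (x $ j)"
  by (simp add: matrix_unit_def matrix_vector_mult_def axis_def vec_eq_iff if_distrib[of "\<lambda>c. c * _"] cong: if_cong)


lemma g2_short_mult_vec:
  "g2_short a *v x = 2 *\<^sub>R axis a (x $ 0) - axis 0 (x $ (-a)) + axis (-2*a) (x $ (4*a)) - axis (-4*a) (x $ (2*a))"
proof -
  have "(2 *\<^sub>R A) *v x = 2 *\<^sub>R (A *v x)" for A :: "complex^7^7"
    by (simp add: matrix_vector_mult_def vec_eq_iff scaleR_sum_right)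
  then show ?thesis
    by (simp add: g2_short_def matrix_vector_mult_add_rdistrib matrix_vector_mult_diff_rdistrib
        matrix_unit_mult_vec)
qed

lemma g2_long_mult_vec: "g2_long i j *v x = axis i (x $ j) - axis (-j) (x $ (-i))"
  by (simp add: g2_long_def matrix_vector_mult_diff_rdistrib matrix_unit_mult_vec)

text \<open>
  As the exponential series stops, the invariance is a polynomial identity in \<open>t\<close> and in the
  coordinates of the three vectors, one for each of the twelve roots.
\<close>
lemma trilinear_root_element:
  assumes "X \<in> g2_root_vectors"
  shows "trilinear (root_element X t *v x) (root_element X t *v y) (root_element X t *v z) = trilinear x y z"
proof -
  have short: "trilinear (root_element (g2_short a) t *v x) (root_element (g2_short a) t *v y) (root_element (g2_short a) t *v z)
      = trilinear x y z" if "a \<noteq> 0" for a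
    using exhaust_7[of a] that
    by (elim disjE)
      (simp_all add: trilinear_def minor3_def root_element_mult_vec g2_short_mult_vec residues_7 axis_def scaleR_conv_of_real,
        simp_all add: algebra_simps power2_eq_square)
  have long: "trilinear (root_element (g2_long i j) t *v x) (root_element (g2_long i j) t *v y) (root_element (g2_long i j) t *v z)
      = trilinear x y z" if "i \<in> {1, 2, 4}" "j \<in> {1, 2, 4}" "i \<noteq> j" for i j
    using that
    by (elim insertE emptyE)
      (simp_all add: trilinear_def minor3_def root_element_mult_vec g2_long_mult_vec residues_7 axis_def,
       simp_all add: algebra_simps)
  show ?thesis
    using assms short long by (auto simp: g2_root_vectors_def)
qed

interpretation g2: integral_root_vectors g2_root_vectors
proof
  show "X ** X ** X = 0" if "X \<in> g2_root_vectors" for X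
    using that by (rule g2_root_vector_cube)
  have unit: "matrix_unit i j $ k $ l \<in> \<int>" for i j k l :: 7
    by (simp add: matrix_unit_def)
  show "X $ i $ j \<in> \<int>" if "X \<in> g2_root_vectors" for X i j
    using that by (auto simp: g2_root_vectors_def g2_short_def g2_long_def scaleR_conv_of_real
        intro!: Ints_add Ints_diff Ints_mult unit)
  (* The factor 2 cancels the denominator of the quadratic term of the exponential series. *)
  have "g2_short a ** g2_short a = (-2) *\<^sub>R matrix_unit a (-a)" if "a \<noteq> 0" for a
    using exhaust_7[of a] that
    by (elim disjE) (simp_all add: g2_short_def residues_7 matrix_unit_mult matrix_mult_distribs)
  then have short: "(g2_short a ** g2_short a) $ i $ j / 2 = - matrix_unit a (-a) $ i $ j" if "a \<noteq> 0" for a i j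
    using that by (simp add: scaleR_conv_of_real)
  have long: "g2_long i j ** g2_long i j = 0" if "i \<in> {1, 2, 4}" "j \<in> {1, 2, 4}" "i \<noteq> j" for i j
    using that by (auto simp: g2_long_def residues_7 matrix_unit_mult matrix_mult_distribs)
  show "(X ** X) $ i $ j / 2 \<in> \<int>" if "X \<in> g2_root_vectors" for X i j
  proof -
    from that show ?thesis
      unfolding g2_root_vectors_def
    proof (elim UnE CollectE exE conjE)
      fix a assume X: "X = g2_short a" and "a \<noteq> 0"
      show ?thesis
        unfolding X short[OF \<open>a \<noteq> 0\<close>] by (intro Ints_minus unit)
    next
      fix k l assume X: "X = g2_long k l" and kl: "k \<in> {1, 2, 4}" "l \<in> {1, 2, 4}" "k \<noteq> l"
      show ?thesis
        unfolding X long[OF kl] by simp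
    qed
  qed
qed

lemma G2_eq: "G2 ring_Q_sqrt_neg7 = matrix_group g2.points"
  by (simp add: G2_def chevalley_demazure_points_def g2.points_def)

lemma trilinear_chevalley_group:
  assumes "A \<in> complex_chevalley_group g2_root_vectors"
  shows "trilinear (A *v x) (A *v y) (A *v z) = trilinear x y z"
  using assms unfolding complex_chevalley_group_def
proof (induction arbitrary: x y z rule: generate.induct)
  case one
  show ?case by (simp add: GL_def)
next
  case (incl h)
  then show ?case using trilinear_root_element by blast
next
  case (inv h)
  then obtain X t where h: "h = root_element X t" "X \<in> g2_root_vectors" by blast
  have "inv\<^bsub>GL\<^esub> h = root_element X (-t)"
    unfolding h(1) by (rule GL_inverse(2)) (rule g2.root_element_inverse(1)[OF h(2)])
  then show ?case using h trilinear_root_element by simp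
next
  case (eng h1 h2)
  then show ?case by (simp add: GL_def matrix_vector_mul_assoc[symmetric])
qed

text \<open>
  For fixed integral vectors the invariance is an integral polynomial relation on the complex group.
\<close>
lemma trilinear_points:
  assumes A: "A \<in> g2.points" and ints: "\<And>i. x $ i \<in> \<int>" "\<And>i. y $ i \<in> \<int>" "\<And>i. z $ i \<in> \<int>"
  shows "trilinear (A *v x) (A *v y) (A *v z) = trilinear x y z"
proof -
  have entry: "(\<lambda>A. (A *v u) $ i) \<in> int_poly_funs" if "\<And>i. u $ i \<in> \<int>" for u :: "complex^7" and i
    unfolding matrix_vector_mult_def
    using that by (simp add: int_poly_sum int_poly_funs.mult int_poly_funs.entry int_poly_Ints_const)
  have "trilinear x y z \<in> \<int>"
    unfolding trilinear_def minor3_def using ints by (intro Ints_add Ints_diff Ints_mult)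
  then have "(\<lambda>A. trilinear (A *v x) (A *v y) (A *v z) - trilinear x y z) \<in> int_poly_funs"
    unfolding trilinear_def minor3_def
    by (intro int_poly_diff int_poly_funs.add int_poly_funs.mult entry ints int_poly_Ints_const)
  then have "trilinear (A *v x) (A *v y) (A *v z) - trilinear x y z = 0"
    by (rule g2.points_vanish[OF A]) (simp add: trilinear_chevalley_group)
  then show ?thesis by simp
qed

lemma residue_trilinear:
  assumes "\<And>i. x $ i \<in> ring_Q_sqrt_neg7" "\<And>i. y $ i \<in> ring_Q_sqrt_neg7" "\<And>i. z $ i \<in> ring_Q_sqrt_neg7"
  shows "residue c (trilinear x y z) = trilinear (residue_vec c x) (residue_vec c y) (residue_vec c z)"
  using assms
  by (simp add: trilinear_def minor3_def residue_vec_def residue_diff ring_mult ring_add ring_diff del: F2_minus)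

lemma trilinear_residue_matrix:
  assumes A: "A \<in> g2.points"
  shows "trilinear (residue_matrix c A *v x) (residue_matrix c A *v y) (residue_matrix c A *v z) = trilinear x y z"
proof -
  have over: "A \<in> matrices_over ring_Q_sqrt_neg7"
    using A g2.points_over_ring by blast
  have "lift_vec u $ i \<in> \<int>" for u :: "2^7" and i
    by (simp add: lift_vec_def)
  then have "residue c (trilinear (A *v lift_vec x) (A *v lift_vec y) (A *v lift_vec z))
      = residue c (trilinear (lift_vec x) (lift_vec y) (lift_vec z))"
    using trilinear_points[OF A] by simp
  then show ?thesis
    using over
    by (simp add: residue_trilinear residue_matrix_vector_mult lift_vec_ring matrix_vector_mult_ring)
qed

section \<open>The lines of the split Cayley hexagon over the field with two elements\<close>

definition collinear_pair :: "2^7 \<Rightarrow> 2^7 \<Rightarrow> bool" where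
  "collinear_pair x y \<longleftrightarrow> x \<noteq> 0 \<and> y \<noteq> 0 \<and> x \<noteq> y \<and> (\<forall>z. trilinear x y z = 0)"

text \<open>
  The lines of the split Cayley hexagon are the planes on which the octonion product vanishes. Each of them
  is represented by the set of its three nonzero vectors.
\<close>
definition hexagon_lines :: "(2^7) set set" where
  "hexagon_lines = {{x, y, x + y} | x y. collinear_pair x y}"

lemma preserves_hexagon_lines:
  assumes M: "invertible M" and inv: "\<And>x y z. trilinear (M *v x) (M *v y) (M *v z) = trilinear x y z"
  shows "preserves hexagon_lines M"
  unfolding preserves_def
proof (intro conjI ballI M)
  fix S assume "S \<in> hexagon_lines"
  then obtain x y where S: "S = {x, y, x + y}" and xy: "collinear_pair x y"
    by (auto simp: hexagon_lines_def)
  have surj: "surj (\<lambda>x. M *v x)"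
    using invertible_surj[OF M] .
  then have inj: "inj (\<lambda>x. M *v x)"
    by (simp add: finite_UNIV_surj_inj)
  obtain u v where uv: "x = M *v u" "y = M *v v"
    using surj by (metis surjD)
  have "collinear_pair u v"
    using xy inv unfolding uv collinear_pair_def by (metis matrix_vector_mult_0_right)
  moreover have "(\<lambda>x. M *v x) -` S = {u, v, u + v}"
    unfolding S uv matrix_vector_right_distrib[symmetric]
    using inj by (auto simp: inj_eq)
  ultimately show "(\<lambda>x. M *v x) -` S \<in> hexagon_lines"
    by (auto simp: hexagon_lines_def)
qed

section \<open>The sign of a short root element\<close>

text \<open>
  The reduction of the element for the short root of index 1; its parameter occurs squared in one entry,
  which makes no difference over \<open>F\<^sub>2\<close>.
\<close>
definition short_root_action :: "2 \<Rightarrow> 2^7 \<Rightarrow> 2^7" where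
  "short_root_action c x = (\<chi> i. x $ i + c * (if i = 0 \<or> i = 1 then x $ 6 else if i = 3 then x $ 2
     else if i = 5 then x $ 4 else 0))"

lemma short_root_action_involution: "short_root_action 1 (short_root_action 1 x) = x"
  by (simp add: short_root_action_def vec_eq_iff forall_7 add.assoc)

lemma residue_short_root_element:
  assumes t: "t \<in> ring_Q_sqrt_neg7"
  shows "residue_matrix c (root_element (g2_short 1) t) *v x = short_root_action (residue c t) x"
proof -
  have "g2_short 1 \<in> g2_root_vectors" by (auto simp: g2_root_vectors_def)
  then have over: "root_element (g2_short 1) t \<in> matrices_over ring_Q_sqrt_neg7"
    using g2.root_element_in_points[OF _ t] g2.points_over_ring by blast
  have "residue_matrix c (root_element (g2_short 1) t) *v residue_vec c (lift_vec x)
      = residue_vec c (root_element (g2_short 1) t *v lift_vec x)"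
    using over by (simp only: residue_matrix_vector_mult lift_vec_ring)
  also have "\<dots> = short_root_action (residue c t) (residue_vec c (lift_vec x))"
  proof -
    define u where "u = lift_vec x"
    have u: "u $ i \<in> ring_Q_sqrt_neg7" for i
      by (simp add: u_def lift_vec_ring)
    have "root_element (g2_short 1) t *v u = (\<chi> i. u $ i +
        (if i = 0 then - t * u $ 6 else if i = 1 then of_int 2 * t * u $ 0 - t * t * u $ 6
         else if i = 3 then - t * u $ 2 else if i = 5 then t * u $ 4 else 0))"
      by (simp add: root_element_mult_vec g2_short_mult_vec vec_eq_iff forall_7 residues_7 axis_def
          scaleR_conv_of_real power2_eq_square)
    moreover have "residue c t * residue c t = residue c t"
      using F2_cases[of "residue c t"] by auto
    ultimately show ?thesis
      using u t ring_of_int[of 2] residue_of_int[of c 2] unfolding u_def[symmetric]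
      by (simp add: vec_eq_iff forall_7 short_root_action_def residue_vec_def residue_diff ring_mult ring_diff
         ring_minus)
  qed
  finally show ?thesis by simp
qed

text \<open>
  The moved lines are counted by evaluation. For this the vectors over \<open>F\<^sub>2\<close> are encoded
  by tuples of truth values, for which addition is exclusive disjunction and multiplication is conjunction.
\<close>
type_synonym bool7 = "bool \<times> bool \<times> bool \<times> bool \<times> bool \<times> bool \<times> bool"

fun vec7 :: "bool7 \<Rightarrow> 2^7" where
  "vec7 (x0, x1, x2, x3, x4, x5, x6) = (\<chi> i. of_bool (if i = 0 then x0 else if i = 1 then x1
     else if i = 2 then x2 else if i = 3 then x3 else if i = 4 then x4 else if i = 5 then x5 else x6))"

fun annihilates7 :: "bool7 \<Rightarrow> bool7 \<Rightarrow> bool" where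
  "annihilates7 (x0, x1, x2, x3, x4, x5, x6) (y0, y1, y2, y3, y4, y5, y6) \<longleftrightarrow>
    ((x6 \<and> y0) \<noteq> (x0 \<and> y6)) = ((x2 \<and> y4) \<noteq> (x4 \<and> y2)) \<and>
    ((x5 \<and> y0) \<noteq> (x0 \<and> y5)) = ((x4 \<and> y1) \<noteq> (x1 \<and> y4)) \<and>
    ((x3 \<and> y0) \<noteq> (x0 \<and> y3)) = ((x1 \<and> y2) \<noteq> (x2 \<and> y1)) \<and>
    ((x0 \<and> y1) \<noteq> (x1 \<and> y0)) = ((x5 \<and> y3) \<noteq> (x3 \<and> y5)) \<and>
    ((x0 \<and> y2) \<noteq> (x2 \<and> y0)) = ((x3 \<and> y6) \<noteq> (x6 \<and> y3)) \<and>
    ((x0 \<and> y4) \<noteq> (x4 \<and> y0)) = ((x6 \<and> y5) \<noteq> (x5 \<and> y6)) \<and>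
    (((x1 \<and> y6) \<noteq> (x6 \<and> y1)) \<noteq> ((x2 \<and> y5) \<noteq> (x5 \<and> y2))) = ((x4 \<and> y3) \<noteq> (x3 \<and> y4))"

fun xor7 :: "bool7 \<Rightarrow> bool7 \<Rightarrow> bool7" where
  "xor7 (x0, x1, x2, x3, x4, x5, x6) (y0, y1, y2, y3, y4, y5, y6) =
    (x0 \<noteq> y0, x1 \<noteq> y1, x2 \<noteq> y2, x3 \<noteq> y3, x4 \<noteq> y4, x5 \<noteq> y5, x6 \<noteq> y6)"

fun act7 :: "bool7 \<Rightarrow> bool7" where
  "act7 (x0, x1, x2, x3, x4, x5, x6) = (x0 \<noteq> x6, x1 \<noteq> x6, x2, x3 \<noteq> x2, x4, x5 \<noteq> x4, x6)"

definition all7 :: "bool7 list" where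
  "all7 = (let bs = [False, True] in List.product bs (List.product bs (List.product bs
     (List.product bs (List.product bs (List.product bs bs))))))"

definition zero7 :: bool7 where "zero7 = (False, False, False, False, False, False, False)"

definition moved_pair7 :: "bool7 \<Rightarrow> bool7 \<Rightarrow> bool" where
  "moved_pair7 x y \<longleftrightarrow> annihilates7 x y \<and> x \<noteq> zero7 \<and> y \<noteq> zero7 \<and> x \<noteq> y \<and>
     \<not> list_all (\<lambda>u. act7 u = x \<or> act7 u = y \<or> act7 u = xor7 x y) [x, y, xor7 x y]"

text \<open>
  A finite check of all pairs of vectors. It is organised as a sum over the first vector, which keeps the
  terms arising in the evaluation small.
\<close>
lemma count_moved_pairs7: "(\<Sum>x\<leftarrow>all7. length (filter (moved_pair7 x) all7)) = 324"
  by code_simp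

lemma length_filter_product:
  "length (filter (\<lambda>(x, y). P x y) (List.product xs ys)) = (\<Sum>x\<leftarrow>xs. length (filter (P x) ys))"
  by (induction xs) (simp_all add: filter_map o_def)

lemma all7: "set all7 = UNIV" "distinct all7"
proof -
  have "set [False, True] = UNIV" by auto
  then show "set all7 = UNIV"
    by (simp only: all7_def Let_def set_product UNIV_Times_UNIV)
  show "distinct all7"
    unfolding all7_def Let_def by (intro distinct_product) simp_all
qed

lemma of_bool_F2:
  "of_bool p + of_bool q = (of_bool (p \<noteq> q) :: 2)" "of_bool p * of_bool q = (of_bool (p \<and> q) :: 2)"
  by (cases p; cases q; simp)+

lemma vec7_bij: "bij vec7"
proof (rule bij_betwI[where g = "\<lambda>x. (x $ 0 = 1, x $ 1 = 1, x $ 2 = 1, x $ 3 = 1, x $ 4 = 1, x $ 5 = 1, x $ 6 = 1)"])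
  show "vec7 (x $ 0 = 1, x $ 1 = 1, x $ 2 = 1, x $ 3 = 1, x $ 4 = 1, x $ 5 = 1, x $ 6 = 1) = x" for x
    using F2_cases[of "x $ 0"] F2_cases[of "x $ 1"] F2_cases[of "x $ 2"] F2_cases[of "x $ 3"]
      F2_cases[of "x $ 4"] F2_cases[of "x $ 5"] F2_cases[of "x $ 6"]
    by (simp add: vec_eq_iff forall_7) auto
  show "(vec7 x $ 0 = 1, vec7 x $ 1 = 1, vec7 x $ 2 = 1, vec7 x $ 3 = 1, vec7 x $ 4 = 1, vec7 x $ 5 = 1, vec7 x $ 6 = 1) = x" for x
    by (cases x) simp
qed auto

lemma vec7_eq_iff: "vec7 x = vec7 y \<longleftrightarrow> x = y"
  using bij_is_inj[OF vec7_bij] by (simp add: inj_eq)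

lemma vec7_simps:
  "vec7 x + vec7 y = vec7 (xor7 x y)"
  "short_root_action 1 (vec7 x) = vec7 (act7 x)"
  "vec7 x = 0 \<longleftrightarrow> x = zero7"
proof -
  show "vec7 x + vec7 y = vec7 (xor7 x y)"
    by (cases x; cases y) (simp add: vec_eq_iff forall_7 of_bool_F2)
  show "short_root_action 1 (vec7 x) = vec7 (act7 x)"
    by (cases x) (simp add: vec_eq_iff forall_7 of_bool_F2 short_root_action_def)
  have "vec7 zero7 = 0"
    by (simp add: zero7_def vec_eq_iff forall_7)
  then show "vec7 x = 0 \<longleftrightarrow> x = zero7"
    by (metis vec7_eq_iff)
qed

text \<open>
  The seven equations are the vanishing of the coefficients of the linear form
  \<open>z \<mapsto> trilinear x y z\<close>, at the coordinates 1, 2, 4, 6, 5, 3, 0 of \<open>z\<close>.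
\<close>
lemma trilinear_zero_iff:
  fixes x y :: "2^7"
  shows "(\<forall>z. trilinear x y z = 0) \<longleftrightarrow>
    (x $ 6 * y $ 0 + x $ 0 * y $ 6) + (x $ 2 * y $ 4 + x $ 4 * y $ 2) = 0 \<and>
    (x $ 5 * y $ 0 + x $ 0 * y $ 5) + (x $ 4 * y $ 1 + x $ 1 * y $ 4) = 0 \<and>
    (x $ 3 * y $ 0 + x $ 0 * y $ 3) + (x $ 1 * y $ 2 + x $ 2 * y $ 1) = 0 \<and>
    (x $ 0 * y $ 1 + x $ 1 * y $ 0) + (x $ 5 * y $ 3 + x $ 3 * y $ 5) = 0 \<and>
    (x $ 0 * y $ 2 + x $ 2 * y $ 0) + (x $ 3 * y $ 6 + x $ 6 * y $ 3) = 0 \<and>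
    (x $ 0 * y $ 4 + x $ 4 * y $ 0) + (x $ 6 * y $ 5 + x $ 5 * y $ 6) = 0 \<and>
    ((x $ 1 * y $ 6 + x $ 6 * y $ 1) + (x $ 2 * y $ 5 + x $ 5 * y $ 2)) + (x $ 4 * y $ 3 + x $ 3 * y $ 4) = 0"
    (is "_ \<longleftrightarrow> ?c1 = 0 \<and> ?c2 = 0 \<and> ?c4 = 0 \<and> ?c6 = 0 \<and> ?c5 = 0 \<and> ?c3 = 0 \<and> ?c0 = 0")
proof -
  have expand: "trilinear x y z = z $ 0 * ?c0 + z $ 1 * ?c1 + z $ 2 * ?c2 + z $ 3 * ?c3 + z $ 4 * ?c4
      + z $ 5 * ?c5 + z $ 6 * ?c6" for z
    unfolding trilinear_def minor3_def by (simp add: algebra_simps)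
  show ?thesis (is "_ \<longleftrightarrow> ?R")
  proof
    assume zero: "\<forall>z. trilinear x y z = 0"
    have "trilinear x y (axis k 1) = 0" for k
      using zero by blast
    from this[of 0] this[of 1] this[of 2] this[of 3] this[of 4] this[of 5] this[of 6] show ?R
      unfolding expand by (simp add: axis_def)
  next
    assume ?R
    then show "\<forall>z. trilinear x y z = 0"
      unfolding expand by simp
  qed
qed

lemma annihilates7_iff: "(\<forall>z. trilinear (vec7 x) (vec7 y) z = 0) \<longleftrightarrow> annihilates7 x y"
  by (cases x; cases y) (simp add: trilinear_zero_iff of_bool_F2)

text \<open>
  The ordered pairs of generators of the moved lines. These are easier to enumerate than the lines
  themselves, and every line has exactly six of them.
\<close>
definition moved_pairs :: "((2^7) \<times> (2^7)) set" where
  "moved_pairs = {(x, y). collinear_pair x y \<and>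
     \<not> short_root_action 1 ` {x, y, x + y} \<subseteq> {x, y, x + y}}"

lemma card_moved_pairs: "card moved_pairs = 324"
proof -
  have iff: "map_prod vec7 vec7 p \<in> moved_pairs \<longleftrightarrow> (\<lambda>(x, y). moved_pair7 x y) p" for p
    by (cases p)
      (auto simp: moved_pairs_def moved_pair7_def collinear_pair_def annihilates7_iff vec7_simps vec7_eq_iff)
  have bij: "bij (map_prod vec7 vec7)"
    using vec7_bij by (simp add: bij_betw_map_prod flip: UNIV_Times_UNIV)
  have "moved_pairs = map_prod vec7 vec7 ` (map_prod vec7 vec7 -` moved_pairs)"
    using bij by (simp add: bij_is_surj surj_image_vimage_eq)
  also have "map_prod vec7 vec7 -` moved_pairs = set (filter (\<lambda>(x, y). moved_pair7 x y) (List.product all7 all7))"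
    by (rule Set.set_eqI)
      (simp only: vimage_eq iff set_filter set_product all7(1) UNIV_Times_UNIV mem_Collect_eq UNIV_I simp_thms)
  finally have "moved_pairs = map_prod vec7 vec7 ` set (filter (\<lambda>(x, y). moved_pair7 x y) (List.product all7 all7))" .
  then have "card moved_pairs = card (set (filter (\<lambda>(x, y). moved_pair7 x y) (List.product all7 all7)))"
    by (rule ssubst) (rule card_image[OF inj_on_subset[OF bij_is_inj[OF bij] subset_UNIV]])
  also have "\<dots> = length (filter (\<lambda>(x, y). moved_pair7 x y) (List.product all7 all7))"
    by (intro distinct_card distinct_filter distinct_product all7)
  finally show ?thesis
    by (simp only: length_filter_product count_moved_pairs7)
qed

text \<open>
  Any two of the three nonzero vectors of a line generate it. That they are again collinear holds because
  the trilinear form is alternating.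
\<close>
lemma collinear_pair_generators:
  assumes "collinear_pair x y" "u \<in> {x, y, x + y}" "v \<in> {x, y, x + y}" "u \<noteq> v"
  shows "collinear_pair u v" "{u, v, u + v} = {x, y, x + y}"
proof -
  have tri: "trilinear v u z = trilinear u v z" "trilinear u (u + v) z = trilinear u v z"
    "trilinear v (u + v) z = trilinear u v z" for u v z :: "2^7"
    by (simp_all add: trilinear_def minor3_def algebra_simps)
  have "x + y \<noteq> 0"
    using assms(1) by (metis F2_vec_add_self(2) add.right_neutral collinear_pair_def)
  then have "collinear_pair y x" "collinear_pair x (x + y)" "collinear_pair (x + y) x"
    "collinear_pair y (x + y)" "collinear_pair (x + y) y"
    using assms(1) unfolding collinear_pair_def by (auto simp: tri add.commute)
  then show "collinear_pair u v" "{u, v, u + v} = {x, y, x + y}"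
    using assms by (auto simp: add.commute)
qed

lemma card_moved_lines:
  "card {S \<in> hexagon_lines. short_root_action 1 -` S \<noteq> S} = 54"
proof -
  define line where "line = (\<lambda>(x, y). {x, y, x + y :: 2^7})"
  define X where "X = {S \<in> hexagon_lines. short_root_action 1 -` S \<noteq> S}"
  have moved: "short_root_action 1 -` S = S \<longleftrightarrow> short_root_action 1 ` S \<subseteq> S" for S
    using short_root_action_involution by (auto simp: image_subset_iff subset_iff)
  have X: "line ` moved_pairs \<subseteq> X"
    by (auto simp: X_def line_def moved_pairs_def moved hexagon_lines_def)
  have fibre: "card {p \<in> moved_pairs. line p = S} = 6" if "S \<in> X" for S
  proof -
    have "S \<in> hexagon_lines"
      using that by (simp add: X_def)
    then obtain x y where S: "S = {x, y, x + y}" and xy: "collinear_pair x y"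
      unfolding hexagon_lines_def by blast
    have S_moved: "\<not> short_root_action 1 ` S \<subseteq> S"
      using that by (simp add: X_def moved)
    have ne: "x \<noteq> y" "x \<noteq> 0" "y \<noteq> 0"
      using xy by (auto simp: collinear_pair_def)
    have "{p \<in> moved_pairs. line p = S} = {(u, v). u \<in> S \<and> v \<in> S \<and> u \<noteq> v}"
    proof (intro equalityI subsetI)
      fix p assume "p \<in> {p \<in> moved_pairs. line p = S}"
      then show "p \<in> {(u, v). u \<in> S \<and> v \<in> S \<and> u \<noteq> v}"
        by (auto simp: moved_pairs_def line_def collinear_pair_def)
    next
      fix p assume "p \<in> {(u, v). u \<in> S \<and> v \<in> S \<and> u \<noteq> v}"
      then obtain u v where p: "p = (u, v)" "u \<in> S" "v \<in> S" "u \<noteq> v" by blast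
      then have "collinear_pair u v" "{u, v, u + v} = S"
        using collinear_pair_generators[OF xy] by (simp_all only: S)
      then show "p \<in> {p \<in> moved_pairs. line p = S}"
        using S_moved by (simp only: p moved_pairs_def line_def mem_Collect_eq case_prod_conv simp_thms)
    qed
    also have "\<dots> = {(x, y), (x, x + y), (y, x), (y, x + y), (x + y, x), (x + y, y)}"
      using ne by (auto simp: S)
    also have "card \<dots> = 6"
      using ne by simp
    finally show ?thesis .
  qed
  have "324 = (\<Sum>S\<in>X. card {p \<in> moved_pairs. line p = S})"
    using card_moved_pairs sum.group[OF _ _ X, of "\<lambda>_. 1::nat"] by simp
  also have "\<dots> = 6 * card X"
    using fibre by simp
  finally show ?thesis
    by (simp add: X_def)
qed

lemma G2_no_single_normal_generator:
  "\<not> generated_by_conj_class (G2 ring_Q_sqrt_neg7)" "Delta 1 (G2 ring_Q_sqrt_neg7) = -\<infinity>"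
proof -
  have inv: "preserves hexagon_lines (residue_matrix c A)" if "A \<in> g2.points" for c A
    using preserves_hexagon_lines[OF residue_matrix_invertible[OF g2.group_points g2.points_over_ring that]]
      trilinear_residue_matrix[OF that] by blast
  have short: "g2_short 1 \<in> g2_root_vectors" by (auto simp: g2_root_vectors_def)
  note elements = g2.root_element_in_points[OF short]
  have even: "residue_matrix c (root_element (g2_short 1) t) = mat 1"
    if "t \<in> ring_Q_sqrt_neg7" "residue c t = 0" for c t
    using residue_short_root_element[OF that(1), of c] that(2)
    by (simp add: matrix_eq short_root_action_def)
  have odd: "family_sign hexagon_lines (residue_matrix c (root_element (g2_short 1) t)) = -1"
    if t: "t \<in> ring_Q_sqrt_neg7" "residue c t = 1" for c t
  proof -
    have action: "(\<lambda>x. residue_matrix c (root_element (g2_short 1) t) *v x) = short_root_action 1"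
      using residue_short_root_element[OF t(1), of c] t(2) by (simp add: fun_eq_iff)
    have "short_root_action 1 -` short_root_action 1 -` S = S" for S
      by (auto simp: short_root_action_involution)
    moreover have "short_root_action 1 -` S \<in> hexagon_lines" if "S \<in> hexagon_lines" for S
      using inv[OF elements[OF t(1)], of c] that unfolding preserves_def action by blast
    ultimately show ?thesis
      unfolding family_sign_def action
      by (subst sign_on_involution) (simp_all add: card_moved_lines)
  qed
  show "\<not> generated_by_conj_class (G2 ring_Q_sqrt_neg7)" "Delta 1 (G2 ring_Q_sqrt_neg7) = -\<infinity>"
    unfolding G2_eq
    by (rule matrix_group_no_single_normal_generator[OF g2.group_points g2.points_over_ring inv elements even odd];
        assumption)+
qed

theorem corollary6p9:
  "\<not> generated_by_conj_class (Sp4 ring_Q_sqrt_neg7) \<and>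
   \<not> generated_by_conj_class (G2 ring_Q_sqrt_neg7) \<and>
   Delta 1 (Sp4 ring_Q_sqrt_neg7) = -\<infinity> \<and>
   Delta 1 (G2 ring_Q_sqrt_neg7) = -\<infinity>"
  using Sp4_no_single_normal_generator G2_no_single_normal_generator by blast

end
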